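(* Let $l=2h+1\ge 3$ be an odd number and let $q$ be a primitive $l$-th root of unity. There is a non-degenerate quadratic form $Q:\mathbb{Z}/l\mathbb{Z}\to\mathbb{Q}/\mathbb{Z}$ such that the projective representation of $\mathrm{SL}(2,\mathbb{Z})$ coming from the pointed modular tensor category $\mathcal{C}(\mathbb{Z}/l\mathbb{Z},Q)$ decomposes as a direct sum $V^{\mathrm{even}}\oplus V^{\mathrm{odd}}$ of subrepresentations, where $V^{\mathrm{even}}$ is the same (as a projective representation) as $\mathcal{P}_{h+1}$ and $V^{\mathrm{odd}}$ is the same (as a projective representation) as $\mathcal{V}_h$.
   Context: Let $s=\begin{pmatrix}0&-1\\1&0\end{pmatrix}$, $t=\begin{pmatrix}1&1\\0&1\end{pmatrix}$ be the standard generators of $\mathrm{SL}(2,\mathbb{Z})$. A quadratic form $Q$ on a finite abelian group $M$ is a map $Q:M\to\mathbb{Q}/\mathbb{Z}$ with $Q(-x)=Q(x)$ and $B(x,y)=Q(x+y)-Q(x)-Q(y)$ bilinear; it is non-degenerate if $B$ is. The projective representation of the pointed modular tensor category $\mathcal{C}(M,Q)$ acts on $\mathbb{C}^M$ by $s\mapsto S$, $t\mapsto T$ (up to scalars), where $S_{x,y}=e^{-2\pi i B(x,y)}$ and $T_{x,y}=\delta_{x,y}e^{2\pi i Q(x)}$. $\mathcal{P}_{h+1}$ is the $(h+1)$-dimensional projective representation on which, in a basis indexed by $r=0,\dots,h$, $s$ and $t$ act (up to scalars) by $(S_N)_{00}=\tfrac1{\sqrt l}$, $(S_N)_{0r}=\tfrac1{\sqrt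 l}$ and $(S_N)_{r0}=\tfrac{2}{\sqrt l}$ for $1\le r\le h$, $(S_N)_{jr}=\tfrac{1}{\sqrt l}(q^{jr}+q^{-jr})$ for $1\le j,r\le h$, and $T_N=\kappa\,\mathrm{diag}\big((-1)^{r+1}q^{\frac12(r^2-1)}\big)_{0\le r\le h}$. $\mathcal{V}_h$ is the $h$-dimensional projective representation on which, in a basis indexed by $r=1,\dots,h$, $s$ and $t$ act (up to scalars) by $(S_V)_{jr}=\tfrac{1}{\sqrt l}(q^{jr}-q^{-jr})$ and $T_V=\kappa\,\mathrm{diag}\big((-1)^{r+1}q^{\frac12(r^2-1)}\big)_{1\le r\le h}$. Here $\kappa$ is a nonzero constant, and $q^{1/2}$ is the square root of $q$ with $(q^{1/2})^l=-1$, so that $(-1)^{r+1}q^{\frac12(r^2-1)}=q^{\frac12(r+1)(2h+r)}$. *)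

theory Defs
  imports
    "HOL-Analysis.Analysis"
    "HOL-Algebra.Elementary_Groups"
    "HOL-Library.Function_Algebras"
begin

section \<open>The group of rationals modulo the integers\<close>

quotient_type qmodz = rat / "\<lambda>x y. x - y \<in> \<int>"
proof (rule equivpI)
  show "reflp (\<lambda>x y::rat. x - y \<in> \<int>)"
    by (simp add: reflp_def)
  show "symp (\<lambda>x y::rat. x - y \<in> \<int>)"
    by (metis (no_types, lifting) Ints_minus minus_diff_eq sympI)
  show "transp (\<lambda>x y::rat. x - y \<in> \<int>)"
  proof (rule transpI)
    fix x y z :: rat
    assume "x - y \<in> \<int>" "y - z \<in> \<int>"
    from Ints_add [OF this] show "x - z \<in> \<int>"
      by simp
  qed
qed

instantiation qmodz :: ab_group_add
begin

lift_definition zero_qmodz :: qmodz is 0 .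

lift_definition plus_qmodz :: "qmodz \<Rightarrow> qmodz \<Rightarrow> qmodz" is "(+)"
  by (metis (no_types, lifting) Ints_add add_diff_add)

lift_definition uminus_qmodz :: "qmodz \<Rightarrow> qmodz" is uminus
  by (metis (no_types, lifting) Ints_minus minus_diff_minus)

definition minus_qmodz :: "qmodz \<Rightarrow> qmodz \<Rightarrow> qmodz"
  where "minus_qmodz x y = x + (- y)"

instance
proof
  fix a b c :: qmodz
  show "a + b + c = a + (b + c)" by transfer (simp add: algebra_simps)
  show "a + b = b + a" by transfer (simp add: algebra_simps)
  show "0 + a = a" by transfer simp
  show "- a + a = 0" by transfer simp
  show "a - b = a + - b" by (rule minus_qmodz_def)
qed

end

text \<open>The character $x \mapsto e^{2\pi i x}$.\<close>

lift_definition qmodz_exp :: "qmodz \<Rightarrow> complex"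
  is "\<lambda>x::rat. exp (2 * complex_of_real pi * \<i> * of_rat x)"
proof -
  fix x y :: rat
  assume "x - y \<in> \<int>"
  then obtain n where "x - y = of_int n"
    by (auto elim: Ints_cases)
  then have "x = y + of_int n"
    by (simp add: algebra_simps)
  then have "2 * complex_of_real pi * \<i> * of_rat x
      = 2 * complex_of_real pi * \<i> * of_rat y + 2 * of_int n * complex_of_real pi * \<i>"
    by (simp add: of_rat_add algebra_simps)
  then show "exp (2 * complex_of_real pi * \<i> * of_rat x)
      = exp (2 * complex_of_real pi * \<i> * of_rat y)"
    by (auto simp: exp_eq)
qed


section \<open>Quadratic forms on finite abelian groups\<close>

definition polar_form ::
    "('a, 'b) monoid_scheme \<Rightarrow> ('a \<Rightarrow> qmodz) \<Rightarrow> 'a \<Rightarrow> 'a \<Rightarrow> qmodz"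
  where "polar_form M Q x y = Q (x \<otimes>\<^bsub>M\<^esub> y) - Q x - Q y"

definition quadratic_form :: "('a, 'b) monoid_scheme \<Rightarrow> ('a \<Rightarrow> qmodz) \<Rightarrow> bool"
  where "quadratic_form M Q \<longleftrightarrow>
    comm_group M \<and> finite (carrier M) \<and>
    (\<forall>x\<in>carrier M. Q (inv\<^bsub>M\<^esub> x) = Q x) \<and>
    (\<forall>x\<in>carrier M. \<forall>y\<in>carrier M. \<forall>z\<in>carrier M.
       polar_form M Q (x \<otimes>\<^bsub>M\<^esub> y) z = polar_form M Q x z + polar_form M Q y z \<and>
       polar_form M Q x (y \<otimes>\<^bsub>M\<^esub> z) = polar_form M Q x y + polar_form M Q x z)"

definition nondegenerate :: "('a, 'b) monoid_scheme \<Rightarrow> ('a \<Rightarrow> qmodz) \<Rightarrow> bool"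
  where "nondegenerate M Q \<longleftrightarrow>
    (\<forall>x\<in>carrier M. (\<forall>y\<in>carrier M. polar_form M Q x y = 0) \<longrightarrow> x = \<one>\<^bsub>M\<^esub>)"


section \<open>Complex vector spaces of functions\<close>

definition cscale :: "complex \<Rightarrow> ('i \<Rightarrow> complex) \<Rightarrow> ('i \<Rightarrow> complex)"
  where "cscale c v = (\<lambda>i. c * v i)"

interpretation cfun: vector_space "cscale :: complex \<Rightarrow> ('i \<Rightarrow> complex) \<Rightarrow> _"
  by unfold_locales (auto simp: cscale_def fun_eq_iff algebra_simps)

text \<open>\<open>coord_space I\<close> is the space $\mathbb{C}^I$ with coordinates indexed by the set \<open>I\<close>.\<close>

definition coord_space :: "'i set \<Rightarrow> ('i \<Rightarrow> complex) set"
  where "coord_space I = {v. \<forall>i. i \<notin> I \<longrightarrow> v i = 0}"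

definition mat_act :: "'i set \<Rightarrow> ('i \<Rightarrow> 'i \<Rightarrow> complex) \<Rightarrow> ('i \<Rightarrow> complex) \<Rightarrow> ('i \<Rightarrow> complex)"
  where "mat_act I A v = (\<lambda>i. if i \<in> I then (\<Sum>j\<in>I. A i j * v j) else 0)"

definition direct_sum_of ::
    "('i \<Rightarrow> complex) set \<Rightarrow> ('i \<Rightarrow> complex) set \<Rightarrow> ('i \<Rightarrow> complex) set \<Rightarrow> bool"
  where "direct_sum_of V U W \<longleftrightarrow>
    cfun.subspace U \<and> cfun.subspace W \<and>
    V = {u + w | u w. u \<in> U \<and> w \<in> W} \<and> U \<inter> W = {0}"


section \<open>Projective representations of SL(2,Z)\<close>

definition SL2Z :: "(int^2^2) set"
  where "SL2Z = {g. det g = 1}"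

definition gen_s :: "int^2^2"
  where "gen_s = vector [vector [0, -1], vector [1, 0]]"

definition gen_t :: "int^2^2"
  where "gen_t = vector [vector [1, 1], vector [0, 1]]"

definition eq_up_to_scalar ::
    "('i \<Rightarrow> complex) set \<Rightarrow> (('i \<Rightarrow> complex) \<Rightarrow> ('j \<Rightarrow> complex)) \<Rightarrow>
     (('i \<Rightarrow> complex) \<Rightarrow> ('j \<Rightarrow> complex)) \<Rightarrow> bool"
  where "eq_up_to_scalar V F G \<longleftrightarrow> (\<exists>c. c \<noteq> 0 \<and> (\<forall>v\<in>V. F v = cscale c (G v)))"

text \<open>
  A projective representation on a space \<open>V\<close> is a homomorphism to \<open>PGL(V)\<close>, given by
  representatives \<open>\<rho> g\<close>. These are linear maps of the ambient function space, but only their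
  values on \<open>V\<close> matter (every linear map on \<open>V\<close> extends to the ambient space). In particular,
  the restriction of \<open>\<rho>\<close> to an invariant subspace \<open>W\<close> is \<open>\<rho>\<close> regarded as acting on \<open>W\<close>.
\<close>

type_synonym 'i proj_action = "int^2^2 \<Rightarrow> ('i \<Rightarrow> complex) \<Rightarrow> ('i \<Rightarrow> complex)"

definition projective_rep :: "('i \<Rightarrow> complex) set \<Rightarrow> 'i proj_action \<Rightarrow> bool"
  where "projective_rep V \<rho> \<longleftrightarrow>
    cfun.subspace V \<and>
    (\<forall>g\<in>SL2Z. Vector_Spaces.linear cscale cscale (\<rho> g) \<and> bij_betw (\<rho> g) V V) \<and>
    (\<forall>g\<in>SL2Z. \<forall>h\<in>SL2Z. eq_up_to_scalar V (\<rho> (g ** h)) (\<rho> g \<circ> \<rho> h))"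

definition projective_subrep ::
    "('i \<Rightarrow> complex) set \<Rightarrow> ('i \<Rightarrow> complex) set \<Rightarrow> 'i proj_action \<Rightarrow> bool"
  where "projective_subrep W V \<rho> \<longleftrightarrow>
    projective_rep V \<rho> \<and> cfun.subspace W \<and> W \<subseteq> V \<and> (\<forall>g\<in>SL2Z. \<rho> g ` W \<subseteq> W)"

definition projective_equiv ::
    "('i \<Rightarrow> complex) set \<Rightarrow> 'i proj_action \<Rightarrow> ('j \<Rightarrow> complex) set \<Rightarrow> 'j proj_action \<Rightarrow> bool"
  where "projective_equiv V \<rho> W \<sigma> \<longleftrightarrow>
    (\<exists>\<phi>. Vector_Spaces.linear cscale cscale \<phi> \<and> bij_betw \<phi> V W \<and>
         (\<forall>g\<in>SL2Z. eq_up_to_scalar V (\<phi> \<circ> \<rho> g) (\<sigma> g \<circ> \<phi>)))"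

text \<open>
  Since \<open>gen_s\<close> and \<open>gen_t\<close> generate \<open>SL2Z\<close>, the following determines the homomorphism to the
  projective linear group uniquely.
\<close>

definition projective_rep_by_matrices ::
    "'i set \<Rightarrow> ('i \<Rightarrow> 'i \<Rightarrow> complex) \<Rightarrow> ('i \<Rightarrow> 'i \<Rightarrow> complex) \<Rightarrow> 'i proj_action \<Rightarrow> bool"
  where "projective_rep_by_matrices I A B \<rho> \<longleftrightarrow>
    projective_rep (coord_space I) \<rho> \<and>
    eq_up_to_scalar (coord_space I) (\<rho> gen_s) (mat_act I A) \<and>
    eq_up_to_scalar (coord_space I) (\<rho> gen_t) (mat_act I B)"


section \<open>The three projective representations\<close>

definition pointed_S ::
    "('a, 'b) monoid_scheme \<Rightarrow> ('a \<Rightarrow> qmodz) \<Rightarrow> 'a \<Rightarrow> 'a \<Rightarrow> complex"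
  where "pointed_S M Q x y = qmodz_exp (- polar_form M Q x y)"

definition pointed_T :: "('a \<Rightarrow> qmodz) \<Rightarrow> 'a \<Rightarrow> 'a \<Rightarrow> complex"
  where "pointed_T Q x y = (if x = y then qmodz_exp (Q x) else 0)"

definition is_pointed_rep ::
    "('a, 'b) monoid_scheme \<Rightarrow> ('a \<Rightarrow> qmodz) \<Rightarrow> 'a proj_action \<Rightarrow> bool"
  where "is_pointed_rep M Q \<rho> \<longleftrightarrow>
    projective_rep_by_matrices (carrier M) (pointed_S M Q) (pointed_T Q) \<rho>"

definition primitive_root_of_unity :: "nat \<Rightarrow> complex \<Rightarrow> bool"
  where "primitive_root_of_unity n z \<longleftrightarrow>
    n > 0 \<and> z ^ n = 1 \<and> (\<forall>k. 0 < k \<and> k < n \<longrightarrow> z ^ k \<noteq> 1)"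

definition S_N :: "nat \<Rightarrow> complex \<Rightarrow> nat \<Rightarrow> nat \<Rightarrow> complex"
  where "S_N l q j r =
    1 / complex_of_real (sqrt (real l)) *
    (if j = 0 then 1
     else if r = 0 then 2
     else q ^ (j * r) + q powi (- int (j * r)))"

definition S_V :: "nat \<Rightarrow> complex \<Rightarrow> nat \<Rightarrow> nat \<Rightarrow> complex"
  where "S_V l q j r =
    1 / complex_of_real (sqrt (real l)) * (q ^ (j * r) - q powi (- int (j * r)))"

text \<open>
  The diagonal matrix common to both representations; \<open>p\<close> plays the role of $q^{1/2}$.
\<close>

definition T_diag :: "complex \<Rightarrow> complex \<Rightarrow> nat \<Rightarrow> nat \<Rightarrow> complex"
  where "T_diag \<kappa> p j r =
    (if j = r then \<kappa> * ((-1) ^ (r + 1) * p powi ((int r)\<^sup>2 - 1)) else 0)"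

definition is_P_rep ::
    "nat \<Rightarrow> complex \<Rightarrow> complex \<Rightarrow> complex \<Rightarrow> nat proj_action \<Rightarrow> bool"
  where "is_P_rep h q p \<kappa> \<sigma> \<longleftrightarrow>
    projective_rep_by_matrices {0..h} (S_N (2 * h + 1) q) (T_diag \<kappa> p) \<sigma>"

definition is_V_rep ::
    "nat \<Rightarrow> complex \<Rightarrow> complex \<Rightarrow> complex \<Rightarrow> nat proj_action \<Rightarrow> bool"
  where "is_V_rep h q p \<kappa> \<tau> \<longleftrightarrow>
    projective_rep_by_matrices {1..h} (S_V (2 * h + 1) q) (T_diag \<kappa> p) \<tau>"

definition even_part :: "('a, 'b) monoid_scheme \<Rightarrow> ('a \<Rightarrow> complex) set"
  where "even_part M =
    {v \<in> coord_space (carrier M). \<forall>x\<in>carrier M. v (inv\<^bsub>M\<^esub> x) = v x}"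

definition odd_part :: "('a, 'b) monoid_scheme \<Rightarrow> ('a \<Rightarrow> complex) set"
  where "odd_part M =
    {v \<in> coord_space (carrier M). \<forall>x\<in>carrier M. v (inv\<^bsub>M\<^esub> x) = - v x}"

end

theory Submission
  imports Defs
begin

text \<open>
  The number \<open>u = - p\<close> is the square root of \<open>q\<close> among the \<open>l\<close>-th roots of unity, so
  \<open>u = exp (2 \<pi> i k / l)\<close> for some \<open>k\<close>, and the quadratic form is \<open>Q x = k x\<^sup>2 / l\<close>. Then
  \<open>T\<close> is multiplication by \<open>u ^ (x\<^sup>2)\<close> and \<open>S\<close> is a Fourier transform with kernel
  \<open>q ^ (- x y)\<close>. Conjugation by \<open>S\<close> and \<open>T\<close> permutes the Heisenberg-Weyl operators through the
  linear action of the matrices \<open>s\<close> and \<open>t\<close>; since an operator with prescribed conjugation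
  action is unique up to a scalar, choosing an intertwiner for every \<open>g\<close> gives the projective
  representation, and no presentation of \<open>SL(2,Z)\<close> is needed. Both \<open>S\<close> and \<open>T\<close> commute with
  \<open>x \<mapsto> - x\<close>, and in the coordinates \<open>v 0, 2 v 1, \<dots>, 2 v h\<close> on even functions and
  \<open>v 1, \<dots>, v h\<close> on odd functions they become, up to scalars, the matrices of the two smaller
  representations.
\<close>

section \<open>Generation of the modular group\<close>

definition mat2 :: "int \<Rightarrow> int \<Rightarrow> int \<Rightarrow> int \<Rightarrow> int^2^2"
  where "mat2 a b c d = vector [vector [a, b], vector [c, d]]"

lemma mat2_nth [simp]:
  "mat2 a b c d $ 1 $ 1 = a" "mat2 a b c d $ 1 $ 2 = b"
  "mat2 a b c d $ 2 $ 1 = c" "mat2 a b c d $ 2 $ 2 = d"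
  by (simp_all add: mat2_def)

lemma mat2_eta: "mat2 (g $ 1 $ 1) (g $ 1 $ 2) (g $ 2 $ 1) (g $ 2 $ 2) = g"
  by (simp add: vec_eq_iff forall_2)

lemma mat2_mult:
  "mat2 a b c d ** mat2 a' b' c' d' =
     mat2 (a * a' + b * c') (a * b' + b * d') (c * a' + d * c') (c * b' + d * d')"
  by (simp add: vec_eq_iff forall_2 matrix_matrix_mult_def sum_2)

lemma gen_s_mat2: "gen_s = mat2 0 (-1) 1 0"
  and gen_t_mat2: "gen_t = mat2 1 1 0 1"
  and one_mat2: "mat 1 = mat2 1 0 0 1"
  by (simp_all add: gen_s_def gen_t_def mat2_def vec_eq_iff forall_2 mat_def)

lemma mat2_in_SL2Z: "mat2 a b c d \<in> SL2Z \<longleftrightarrow> a * d - b * c = 1"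
  by (simp add: SL2Z_def det_2)

lemma SL2Z_gens [simp]: "gen_s \<in> SL2Z" "gen_t \<in> SL2Z" "mat 1 \<in> SL2Z"
  by (simp_all add: gen_s_mat2 gen_t_mat2 one_mat2 mat2_in_SL2Z)

lemma SL2Z_mult: "g \<in> SL2Z \<Longrightarrow> g' \<in> SL2Z \<Longrightarrow> g ** g' \<in> SL2Z"
  by (simp add: SL2Z_def det_mul)

lemma SL2Z_right_inverse:
  assumes "g \<in> SL2Z"
  shows "\<exists>g'\<in>SL2Z. g ** g' = mat 1"
proof -
  obtain a b c d where g: "g = mat2 a b c d" by (metis mat2_eta)
  have "mat2 d (-b) (-c) a \<in> SL2Z" "g ** mat2 d (-b) (-c) a = mat 1"
    using assms by (simp_all add: g mat2_in_SL2Z mat2_mult one_mat2 algebra_simps)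
  then show ?thesis by blast
qed

text \<open>Inverses of the generators are positive words in them, so closure under left
  multiplication by the generators suffices.\<close>

lemma SL2Z_induct [consumes 1, case_names one s t]:
  assumes "g \<in> SL2Z" and one: "P (mat 1)"
    and s: "\<And>g. g \<in> SL2Z \<Longrightarrow> P g \<Longrightarrow> P (gen_s ** g)"
    and t: "\<And>g. g \<in> SL2Z \<Longrightarrow> P g \<Longrightarrow> P (gen_t ** g)"
  shows "P g"
proof -
  define R where "R g \<longleftrightarrow> g \<in> SL2Z \<and> P g" for g
  have Rs: "R (mat2 a b c d) \<Longrightarrow> R (mat2 (-c) (-d) a b)" for a b c d
    using s [of "mat2 a b c d"] SL2Z_mult [OF SL2Z_gens(1), of "mat2 a b c d"]
    by (auto simp: R_def gen_s_mat2 mat2_mult)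
  have Rt: "R (mat2 a b c d) \<Longrightarrow> R (mat2 (a + c) (b + d) c d)" for a b c d
    using t [of "mat2 a b c d"] SL2Z_mult [OF SL2Z_gens(2), of "mat2 a b c d"]
    by (auto simp: R_def gen_t_mat2 mat2_mult)
  have Rs': "R (mat2 a b c d) \<Longrightarrow> R (mat2 c d (-a) (-b))" for a b c d
    by (drule Rs, drule Rs, drule Rs) simp
  \<comment> \<open>The relation \<open>(s t)^3 = s^2\<close> gives
    \<open>t^-1 = s^-1 t s t s\<close>, and \<open>s^-1 = s^3\<close>, so both inverses are positive
    words.\<close>
  have Rt': "R (mat2 a b c d) \<Longrightarrow> R (mat2 (a - c) (b - d) c d)" for a b c d
    by (drule Rs, drule Rt, drule Rs, drule Rt, drule Rs') simp
  have pos: "R (mat2 a b c d) \<Longrightarrow> R (mat2 (a + int n * c) (b + int n * d) c d)" for a b c d n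
  proof (induction n)
    case (Suc n)
    from Rt [OF Suc.IH [OF Suc.prems]] show ?case by (simp add: algebra_simps)
  qed simp
  have neg: "R (mat2 a b c d) \<Longrightarrow> R (mat2 (a - int n * c) (b - int n * d) c d)" for a b c d n
  proof (induction n)
    case (Suc n)
    from Rt' [OF Suc.IH [OF Suc.prems]] show ?case by (simp add: algebra_simps)
  qed simp
  have shift: "R (mat2 (a + n * c) (b + n * d) c d)" if "R (mat2 a b c d)" for a b c d n
    using pos [OF that, of "nat n"] neg [OF that, of "nat (-n)"]
    by (cases "n \<ge> 0") (simp_all add: algebra_simps)
  have R1: "R (mat2 1 0 0 1)" using one SL2Z_gens(3) by (metis R_def one_mat2)
  \<comment> \<open>Euclid's algorithm on the first column: subtracting \<open>a div c\<close> times
    the second row leaves \<open>a mod c\<close> on top, and \<open>s\<close> moves this smaller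
    entry to the lower left corner.\<close>
  have "R (mat2 a b c d)" if "a * d - b * c = 1" for a b c d
    using that
  proof (induction "nat \<bar>c\<bar>" arbitrary: a b c d rule: less_induct)
    case less
    show ?case
    proof (cases "c = 0")
      case True
      then have "a * d = 1" using less.prems by simp
      then consider "a = 1" "d = 1" | "a = -1" "d = -1" by (auto simp: zmult_eq_1_iff)
      then show ?thesis
      proof cases
        case 1 then show ?thesis using shift [OF R1, of b] True by simp
      next
        \<comment> \<open>The matrix \<open>- 1\<close> is \<open>s^2\<close>. Its lower right entry
          is \<open>-1\<close>, hence the shift by \<open>-b\<close>.\<close>
        case 2 then show ?thesis using shift [OF Rs [OF Rs [OF R1]], of "-b"] True by simp
      qed
    next
      case False
      define n where "n = a div c"
      have m: "a - n * c = a mod c" by (simp add: n_def minus_div_mult_eq_mod)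
      have "R (mat2 (-c) (-d) (a - n * c) (b - n * d))"
      proof (rule less.hyps)
        show "nat \<bar>a - n * c\<bar> < nat \<bar>c\<bar>" unfolding m using False
          by (simp add: abs_mod_less)
        show "- c * (b - n * d) - - d * (a - n * c) = 1"
          using less.prems by (simp add: algebra_simps)
      qed
      from shift [OF Rs' [OF this], of n] show ?thesis by simp
    qed
  qed
  then show ?thesis using assms(1) mat2_eta [of g] mat2_in_SL2Z by (metis R_def)
qed


section \<open>Projective representations and their generators\<close>

lemma cfun_linearI:
  assumes "\<And>v w. F (v + w) = F v + F w" "\<And>c v. F (cscale c v) = cscale c (F v)"
  shows "Vector_Spaces.linear cscale cscale F"
  using assms by (simp add: Vector_Spaces.linear_iff cfun.vector_space_axioms)

lemma cfun_linear_cscale: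
  "Vector_Spaces.linear cscale cscale F \<Longrightarrow> F (cscale c v) = cscale c (F v)"
  by (simp add: Vector_Spaces.linear_iff)

lemma cscale_cscale [simp]: "cscale a (cscale b v) = cscale (a * b) v"
  by (simp add: cscale_def mult.assoc)

lemma cscale_one [simp]: "cscale 1 v = v"
  by (simp add: cscale_def)

lemma eq_up_to_scalarE:
  assumes "eq_up_to_scalar V F G"
  obtains c where "c \<noteq> 0" "\<And>v. v \<in> V \<Longrightarrow> F v = cscale c (G v)"
  using assms by (auto simp: eq_up_to_scalar_def)

lemma projective_repD:
  assumes "projective_rep V \<rho>"
  shows "cfun.subspace V"
    and "g \<in> SL2Z \<Longrightarrow> Vector_Spaces.linear cscale cscale (\<rho> g)"
    and "g \<in> SL2Z \<Longrightarrow> bij_betw (\<rho> g) V V"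
    and "g \<in> SL2Z \<Longrightarrow> g' \<in> SL2Z \<Longrightarrow> eq_up_to_scalar V (\<rho> (g ** g')) (\<rho> g \<circ> \<rho> g')"
  using assms by (auto simp: projective_rep_def)

text \<open>Since \<open>mat 1\<close> is its own square, its operator \<open>R\<close> satisfies
  \<open>R = c R^2\<close> on \<open>V\<close>, and injectivity cancels one
  \<open>R\<close>.\<close>

lemma projective_rep_one:
  assumes "projective_rep V \<rho>"
  shows "eq_up_to_scalar V (\<rho> (mat 1)) id"
proof -
  define R where "R = \<rho> (mat 1)"
  note \<rho> = projective_repD [OF assms]
  have lin: "Vector_Spaces.linear cscale cscale R" and bij: "bij_betw R V V"
    using \<rho>(2,3) by (simp_all add: R_def)
  have "eq_up_to_scalar V R (R \<circ> R)"
    using \<rho>(4) [OF SL2Z_gens(3) SL2Z_gens(3)] by (simp add: R_def)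
  then obtain c where c: "c \<noteq> 0" "\<forall>v\<in>V. R v = cscale c ((R \<circ> R) v)"
    by (auto simp only: eq_up_to_scalar_def)
  have "R v = cscale (1 / c) v" if v: "v \<in> V" for v
  proof -
    have V: "R v \<in> V" using bij v by (simp add: bij_betw_apply)
    have "R (cscale c (R v)) = R v"
      using bspec [OF c(2) v] by (simp only: cfun_linear_cscale [OF lin] comp_apply)
    then have "cscale c (R v) = v"
      using inj_onD [OF bij_betw_imp_inj_on [OF bij]] V v cfun.subspace_scale [OF \<rho>(1)] by blast
    then have "cscale (1 / c) (cscale c (R v)) = cscale (1 / c) v" by (simp only:)
    then show ?thesis using c(1) by simp
  qed
  then show ?thesis using c(1) unfolding eq_up_to_scalar_def R_def
    by (intro exI [of _ "1 / c"]) simp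
qed

text \<open>Invariance only has to be tested on the generators, because a subspace absorbs the
  scalar that each product introduces.\<close>

lemma projective_subrepI:
  assumes \<rho>: "projective_rep V \<rho>" and W: "cfun.subspace W" "W \<subseteq> V"
    and s: "\<And>v. v \<in> W \<Longrightarrow> \<rho> gen_s v \<in> W" and t: "\<And>v. v \<in> W \<Longrightarrow> \<rho> gen_t v \<in> W"
  shows "projective_subrep W V \<rho>"
proof -
  have step: "\<forall>v\<in>W. \<rho> (x ** g) v \<in> W"
    if "x \<in> SL2Z" "g \<in> SL2Z" "\<forall>v\<in>W. \<rho> g v \<in> W" "\<And>v. v \<in> W \<Longrightarrow> \<rho> x v \<in> W" for x g
    using projective_repD(4) [OF \<rho> that(1,2)] that(3,4) W
    by (force simp: eq_up_to_scalar_def intro: cfun.subspace_scale)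
  have "\<forall>v\<in>W. \<rho> g v \<in> W" if "g \<in> SL2Z" for g
    using that
  proof (induction rule: SL2Z_induct)
    case one
    show ?case using projective_rep_one [OF \<rho>] W
      by (force simp: eq_up_to_scalar_def intro: cfun.subspace_scale)
  qed (use step s t in \<open>simp_all\<close>)
  then show ?thesis using \<rho> W by (auto simp: projective_subrep_def)
qed

text \<open>Invariance is only an inclusion. Surjectivity on \<open>W\<close> comes from the
  operator of the inverse matrix, which preserves \<open>W\<close> as well, so no dimension count is
  involved.\<close>

lemma projective_subrep_imp_rep:
  assumes "projective_subrep W V \<rho>"
  shows "projective_rep W \<rho>"
proof -
  from assms have \<rho>: "projective_rep V \<rho>" and W: "cfun.subspace W" "W \<subseteq> V"
    and inv: "\<And>g v. g \<in> SL2Z \<Longrightarrow> v \<in> W \<Longrightarrow> \<rho> g v \<in> W"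
    by (auto simp: projective_subrep_def)
  have "bij_betw (\<rho> g) W W" if g: "g \<in> SL2Z" for g
  proof -
    obtain g' where g': "g' \<in> SL2Z" "g ** g' = mat 1" using SL2Z_right_inverse [OF g] by blast
    obtain c where c: "c \<noteq> 0" "\<And>v. v \<in> V \<Longrightarrow> \<rho> (mat 1) v = cscale c (\<rho> g (\<rho> g' v))"
      using projective_repD(4) [OF \<rho> g g'(1)] unfolding comp_def g'(2) by (rule eq_up_to_scalarE) blast
    obtain d where d: "d \<noteq> 0" "\<And>v. v \<in> V \<Longrightarrow> \<rho> (mat 1) v = cscale d v"
      using projective_rep_one [OF \<rho>] unfolding comp_def id_def by (rule eq_up_to_scalarE) blast
    have "v \<in> \<rho> g ` W" if v: "v \<in> W" for v
    proof -
      have "cscale (1 / d) (cscale d v) = cscale (1 / d) (cscale c (\<rho> g (\<rho> g' v)))"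
        using c(2) d(2) v W(2) by (metis subsetD)
      then have "\<rho> g (cscale (c / d) (\<rho> g' v)) = v"
        using d(1) by (simp add: cfun_linear_cscale [OF projective_repD(2) [OF \<rho> g]])
      then show ?thesis using inv [OF g'(1) v] cfun.subspace_scale [OF W(1)] by (metis imageI)
    qed
    then have "\<rho> g ` W = W" using inv [OF g] by auto
    moreover have "inj_on (\<rho> g) W"
      using projective_repD(3) [OF \<rho> g] W(2) by (auto simp: bij_betw_def intro: inj_on_subset)
    ultimately show ?thesis by (simp add: bij_betw_def)
  qed
  moreover have "eq_up_to_scalar W (\<rho> (g ** g')) (\<rho> g \<circ> \<rho> g')"
    if "g \<in> SL2Z" "g' \<in> SL2Z" for g g'
    using projective_repD(4) [OF \<rho> that] W(2) by (auto simp: eq_up_to_scalar_def)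
  ultimately show ?thesis using W(1) projective_repD(2) [OF \<rho>] by (simp add: projective_rep_def)
qed

text \<open>The scalar in the intertwining relation may depend on \<open>g\<close>, so the relation
  passes from the generators to all words; the scalars just multiply along a word.\<close>

lemma projective_equivI:
  assumes \<rho>: "projective_rep V \<rho>" and \<sigma>: "projective_rep W \<sigma>"
    and \<phi>: "Vector_Spaces.linear cscale cscale \<phi>" "bij_betw \<phi> V W"
    and s: "eq_up_to_scalar V (\<phi> \<circ> \<rho> gen_s) (\<sigma> gen_s \<circ> \<phi>)"
    and t: "eq_up_to_scalar V (\<phi> \<circ> \<rho> gen_t) (\<sigma> gen_t \<circ> \<phi>)"
  shows "projective_equiv V \<rho> W \<sigma>"
proof -
  have V: "\<rho> g v \<in> V" if "g \<in> SL2Z" "v \<in> V" for g v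
    using projective_repD(3) [OF \<rho> that(1)] that(2) by (auto simp: bij_betw_def)
  have W: "\<phi> v \<in> W" if "v \<in> V" for v using \<phi>(2) that by (auto simp: bij_betw_def)
  have step: "eq_up_to_scalar V (\<phi> \<circ> \<rho> (x ** g)) (\<sigma> (x ** g) \<circ> \<phi>)"
    if x: "x \<in> SL2Z" and g: "g \<in> SL2Z" and ih: "eq_up_to_scalar V (\<phi> \<circ> \<rho> g) (\<sigma> g \<circ> \<phi>)"
      and h: "eq_up_to_scalar V (\<phi> \<circ> \<rho> x) (\<sigma> x \<circ> \<phi>)" for x g
  proof -
    obtain a where a: "a \<noteq> 0" "\<And>v. v \<in> V \<Longrightarrow> \<rho> (x ** g) v = cscale a (\<rho> x (\<rho> g v))"
      using projective_repD(4) [OF \<rho> x g] unfolding comp_def id_def by (rule eq_up_to_scalarE) blast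
    obtain b where b: "b \<noteq> 0" "\<And>v. v \<in> W \<Longrightarrow> \<sigma> (x ** g) v = cscale b (\<sigma> x (\<sigma> g v))"
      using projective_repD(4) [OF \<sigma> x g] unfolding comp_def id_def by (rule eq_up_to_scalarE) blast
    obtain c where c: "c \<noteq> 0" "\<And>v. v \<in> V \<Longrightarrow> \<phi> (\<rho> g v) = cscale c (\<sigma> g (\<phi> v))"
      using ih unfolding comp_def id_def by (rule eq_up_to_scalarE) blast
    obtain d where d: "d \<noteq> 0" "\<And>v. v \<in> V \<Longrightarrow> \<phi> (\<rho> x v) = cscale d (\<sigma> x (\<phi> v))"
      using h unfolding comp_def id_def by (rule eq_up_to_scalarE) blast
    have "\<phi> (\<rho> (x ** g) v) = cscale (a * d * c / b) (\<sigma> (x ** g) (\<phi> v))" if v: "v \<in> V" for v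
      using a(2) [OF v] b(1) b(2) [OF W [OF v]] c(2) [OF v] d(2) [OF V [OF g v]]
      by (simp add: cfun_linear_cscale [OF \<phi>(1)] cfun_linear_cscale [OF projective_repD(2) [OF \<sigma> x]])
    then show ?thesis using a b c d unfolding eq_up_to_scalar_def
      by (intro exI [of _ "a * d * c / b"]) simp
  qed
  have "eq_up_to_scalar V (\<phi> \<circ> \<rho> g) (\<sigma> g \<circ> \<phi>)" if "g \<in> SL2Z" for g
    using that
  proof (induction rule: SL2Z_induct)
    case one
    obtain a where a: "a \<noteq> 0" "\<And>v. v \<in> V \<Longrightarrow> \<rho> (mat 1) v = cscale a v"
      using projective_rep_one [OF \<rho>] unfolding comp_def id_def by (rule eq_up_to_scalarE) blast
    obtain b where b: "b \<noteq> 0" "\<And>v. v \<in> W \<Longrightarrow> \<sigma> (mat 1) v = cscale b v"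
      using projective_rep_one [OF \<sigma>] unfolding comp_def id_def by (rule eq_up_to_scalarE) blast
    show ?case using a b W unfolding eq_up_to_scalar_def
      by (intro exI [of _ "a / b"]) (simp add: cfun_linear_cscale [OF \<phi>(1)])
  qed (blast intro: step s t SL2Z_gens)+
  then show ?thesis using \<phi> by (auto simp: projective_equiv_def)
qed

text \<open>Conjugation by \<open>\<phi>\<close>. The inverse is supplied as a map
  \<open>\<psi>\<close> that is linear on the whole function space, since
  \<open>projective_rep\<close> demands this of its operators.\<close>

lemma projective_rep_transport:
  assumes \<rho>: "projective_rep V \<rho>" and U: "cfun.subspace U"
    and \<phi>: "Vector_Spaces.linear cscale cscale \<phi>" "bij_betw \<phi> V U"
    and \<psi>: "Vector_Spaces.linear cscale cscale \<psi>" "\<And>v. v \<in> V \<Longrightarrow> \<psi> (\<phi> v) = v"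
  shows "projective_rep U (\<lambda>g. \<phi> \<circ> \<rho> g \<circ> \<psi>)"
proof -
  have \<psi>b: "bij_betw \<psi> U V"
    using \<phi>(2) \<psi>(2) by (force simp: bij_betw_def inj_on_def image_iff)
  have "eq_up_to_scalar U (\<phi> \<circ> \<rho> (g ** g') \<circ> \<psi>) ((\<phi> \<circ> \<rho> g \<circ> \<psi>) \<circ> (\<phi> \<circ> \<rho> g' \<circ> \<psi>))"
    if g: "g \<in> SL2Z" "g' \<in> SL2Z" for g g'
  proof -
    obtain a where a: "a \<noteq> 0" "\<And>v. v \<in> V \<Longrightarrow> \<rho> (g ** g') v = cscale a (\<rho> g (\<rho> g' v))"
      using projective_repD(4) [OF \<rho> g] unfolding comp_def id_def by (rule eq_up_to_scalarE) blast
    have "\<psi> u \<in> V" "\<rho> g' (\<psi> u) \<in> V" if "u \<in> U" for u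
      using \<psi>b projective_repD(3) [OF \<rho> g(2)] that by (auto simp: bij_betw_def)
    then show ?thesis using a \<psi>(2) unfolding eq_up_to_scalar_def
      by (intro exI [of _ a]) (simp add: cfun_linear_cscale [OF \<phi>(1)])
  qed
  moreover have "Vector_Spaces.linear cscale cscale (\<phi> \<circ> \<rho> g \<circ> \<psi>)" if "g \<in> SL2Z" for g
    by (rule Vector_Spaces.linear_compose [OF \<psi>(1)
          Vector_Spaces.linear_compose [OF projective_repD(2) [OF \<rho> that] \<phi>(1)]])
  moreover have "bij_betw (\<phi> \<circ> \<rho> g \<circ> \<psi>) U U" if "g \<in> SL2Z" for g
    using bij_betw_trans [OF \<psi>b bij_betw_trans [OF projective_repD(3) [OF \<rho> that] \<phi>(2)]]
    by (simp add: comp_assoc)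
  ultimately show ?thesis using U by (simp add: projective_rep_def)
qed

section \<open>Representations given by the matrices of the generators\<close>

lemma coord_space_subspace: "cfun.subspace (coord_space I)"
  by (auto simp: cfun.subspace_def coord_space_def cscale_def)

lemma mat_act_linear: "Vector_Spaces.linear cscale cscale (mat_act I A)"
  by (rule cfun_linearI)
    (auto simp: mat_act_def fun_eq_iff cscale_def algebra_simps sum.distrib sum_distrib_left)

lemma mat_act_in_coord_space: "mat_act I A v \<in> coord_space I"
  by (simp add: mat_act_def coord_space_def)

lemma projective_subrep_by_matrices:
  assumes \<rho>: "projective_rep_by_matrices I A B \<rho>"
    and W: "cfun.subspace W" "W \<subseteq> coord_space I"
    and A: "\<And>v. v \<in> W \<Longrightarrow> mat_act I A v \<in> W" and B: "\<And>v. v \<in> W \<Longrightarrow> mat_act I B v \<in> W"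
  shows "projective_subrep W (coord_space I) \<rho>"
proof (rule projective_subrepI)
  from \<rho> obtain a b
    where "\<And>v. v \<in> coord_space I \<Longrightarrow> \<rho> gen_s v = cscale a (mat_act I A v)"
      and "\<And>v. v \<in> coord_space I \<Longrightarrow> \<rho> gen_t v = cscale b (mat_act I B v)"
    by (auto simp: projective_rep_by_matrices_def eq_up_to_scalar_def)
  then show "\<rho> gen_s v \<in> W" "\<rho> gen_t v \<in> W" if "v \<in> W" for v
    using that W A B by (metis cfun.subspace_scale subsetD)+
qed (use \<rho> W in \<open>auto simp: projective_rep_by_matrices_def\<close>)

text \<open>Reduces an equivalence to a computation with matrices: the scalars left open in
  \<open>\<rho>\<close> and \<open>\<sigma>\<close> on the generators are absorbed into the
  intertwining scalar.\<close>

lemma subrep_by_matrices_equiv: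
  assumes \<rho>: "projective_rep_by_matrices I A B \<rho>"
    and sub: "projective_subrep W (coord_space I) \<rho>"
    and \<phi>: "Vector_Spaces.linear cscale cscale \<phi>" "bij_betw \<phi> W (coord_space J)"
    and s: "eq_up_to_scalar W (\<phi> \<circ> mat_act I A) (mat_act J A' \<circ> \<phi>)"
    and t: "eq_up_to_scalar W (\<phi> \<circ> mat_act I B) (mat_act J B' \<circ> \<phi>)"
    and \<sigma>: "projective_rep_by_matrices J A' B' \<sigma>"
  shows "projective_equiv W \<rho> (coord_space J) \<sigma>"
proof (rule projective_equivI)
  have W: "W \<subseteq> coord_space I" using sub by (auto simp: projective_subrep_def)
  have gen: "eq_up_to_scalar W (\<phi> \<circ> R) (S \<circ> \<phi>)"
    if h1: "eq_up_to_scalar (coord_space I) R M" and h2: "eq_up_to_scalar (coord_space J) S N"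
      and h3: "eq_up_to_scalar W (\<phi> \<circ> M) (N \<circ> \<phi>)" for R S M N
  proof -
    obtain a where a: "a \<noteq> 0" "\<And>v. v \<in> coord_space I \<Longrightarrow> R v = cscale a (M v)"
      using h1 unfolding comp_def id_def by (rule eq_up_to_scalarE) blast
    obtain b where b: "b \<noteq> 0" "\<And>v. v \<in> coord_space J \<Longrightarrow> S v = cscale b (N v)"
      using h2 unfolding comp_def id_def by (rule eq_up_to_scalarE) blast
    obtain c where c: "c \<noteq> 0" "\<And>v. v \<in> W \<Longrightarrow> \<phi> (M v) = cscale c (N (\<phi> v))"
      using h3 unfolding comp_def id_def by (rule eq_up_to_scalarE) blast
    have "\<phi> v \<in> coord_space J" if "v \<in> W" for v using \<phi>(2) that by (auto simp: bij_betw_def)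
    then show ?thesis using a b c W unfolding eq_up_to_scalar_def
      by (intro exI [of _ "a * c / b"]) (auto simp: subset_iff cfun_linear_cscale [OF \<phi>(1)])
  qed
  show "eq_up_to_scalar W (\<phi> \<circ> \<rho> gen_s) (\<sigma> gen_s \<circ> \<phi>)"
    "eq_up_to_scalar W (\<phi> \<circ> \<rho> gen_t) (\<sigma> gen_t \<circ> \<phi>)"
    using \<rho> \<sigma> s t gen by (auto simp: projective_rep_by_matrices_def)
qed (use projective_subrep_imp_rep [OF sub] \<phi> \<sigma> in \<open>auto simp: projective_rep_by_matrices_def\<close>)

text \<open>The existence counterpart of the preceding lemma: the restriction to \<open>W\<close>,
  conjugated by \<open>\<phi>\<close>, realises the matrices \<open>A'\<close> and
  \<open>B'\<close>.\<close>

lemma subrep_by_matrices_transport: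
  assumes \<rho>: "projective_rep_by_matrices I A B \<rho>"
    and sub: "projective_subrep W (coord_space I) \<rho>"
    and \<phi>: "Vector_Spaces.linear cscale cscale \<phi>" "bij_betw \<phi> W (coord_space J)"
    and \<psi>: "Vector_Spaces.linear cscale cscale \<psi>" "\<And>v. v \<in> W \<Longrightarrow> \<psi> (\<phi> v) = v"
    and s: "eq_up_to_scalar W (\<phi> \<circ> mat_act I A) (mat_act J A' \<circ> \<phi>)"
    and t: "eq_up_to_scalar W (\<phi> \<circ> mat_act I B) (mat_act J B' \<circ> \<phi>)"
  shows "\<exists>\<sigma>. projective_rep_by_matrices J A' B' \<sigma>"
proof -
  have W: "W \<subseteq> coord_space I" using sub by (auto simp: projective_subrep_def)
  have gen: "eq_up_to_scalar (coord_space J) (\<phi> \<circ> R \<circ> \<psi>) N"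
    if h1: "eq_up_to_scalar (coord_space I) R M" and h2: "eq_up_to_scalar W (\<phi> \<circ> M) (N \<circ> \<phi>)" for R M N
  proof -
    obtain a where a: "a \<noteq> 0" "\<And>v. v \<in> coord_space I \<Longrightarrow> R v = cscale a (M v)"
      using h1 unfolding comp_def id_def by (rule eq_up_to_scalarE) blast
    obtain c where c: "c \<noteq> 0" "\<And>v. v \<in> W \<Longrightarrow> \<phi> (M v) = cscale c (N (\<phi> v))"
      using h2 unfolding comp_def id_def by (rule eq_up_to_scalarE) blast
    have "\<phi> (R (\<psi> u)) = cscale (a * c) (N u)" if u: "u \<in> coord_space J" for u
    proof -
      obtain w where "w \<in> W" "u = \<phi> w" using \<phi>(2) u by (auto simp: bij_betw_def)
      then show ?thesis using a c W \<psi>(2) by (auto simp: subset_iff cfun_linear_cscale [OF \<phi>(1)])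
    qed
    then show ?thesis using a c unfolding eq_up_to_scalar_def
      by (intro exI [of _ "a * c"]) simp
  qed
  have "projective_rep_by_matrices J A' B' (\<lambda>g. \<phi> \<circ> \<rho> g \<circ> \<psi>)"
    using projective_rep_transport [OF projective_subrep_imp_rep [OF sub] coord_space_subspace \<phi> \<psi>]
      gen \<rho> s t by (auto simp: projective_rep_by_matrices_def)
  then show ?thesis by blast
qed

text \<open>Residues modulo \<open>2 * h + 1\<close> fall into orbits under negation: 0 alone, and
  \<open>h\<close> pairs consisting of \<open>r\<close> and its negative.\<close>

lemma sum_odd_range_fold:
  fixes F :: "int \<Rightarrow> complex"
  shows "(\<Sum>y\<in>{0..<int (2 * h + 1)}. F y) =
    F 0 + (\<Sum>r\<in>{1..h}. F (int r) + F (int (2 * h + 1) - int r))"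
proof -
  let ?A = "int ` {1..h}" and ?B = "(\<lambda>r. int (2 * h + 1) - int r) ` {1..h}"
  have "x \<in> insert 0 (?A \<union> ?B)" if "x \<in> {0..<int (2 * h + 1)}" for x
  proof -
    have "0 \<le> x" using that by simp
    then consider "x = 0" | "1 \<le> x" "x \<le> int h" | "int h < x" by linarith
    then show ?thesis
    proof cases
      case 2
      then have "x = int (nat x)" "nat x \<in> {1..h}" by auto
      then show ?thesis by blast
    next
      case 3
      then have "x = int (2 * h + 1) - int (nat (int (2 * h + 1) - x))"
        "nat (int (2 * h + 1) - x) \<in> {1..h}" using that by auto
      then show ?thesis by blast
    qed simp
  qed
  moreover have "insert 0 (?A \<union> ?B) \<subseteq> {0..<int (2 * h + 1)}" by auto
  moreover have nz: "0 \<notin> ?A \<union> ?B" and disj: "?A \<inter> ?B = {}" by auto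
  ultimately have split: "{0..<int (2 * h + 1)} = insert 0 (?A \<union> ?B)" by blast
  have fin: "finite ?A" "finite ?B" by simp_all
  have "sum F {0..<int (2 * h + 1)} = F 0 + (sum F ?A + sum F ?B)"
    unfolding split sum.insert [OF finite_UnI [OF fin] nz] sum.union_disjoint [OF fin disj] ..
  also have "sum F ?A = (\<Sum>r\<in>{1..h}. F (int r))" by (simp add: sum.reindex)
  also have "sum F ?B = (\<Sum>r\<in>{1..h}. F (int (2 * h + 1) - int r))"
    by (subst sum.reindex) (auto simp: inj_on_def)
  finally show ?thesis by (simp add: sum.distrib)
qed

lemma sum_fun_eval: "(\<Sum>a\<in>A. F a) x = (\<Sum>a\<in>A. F a x)"
  for F :: "'a \<Rightarrow> 'b \<Rightarrow> complex"
  by (induction A rule: infinite_finite_induct) auto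

section \<open>The Weil representation\<close>

locale odd_root =
  fixes l :: nat and u :: complex
  assumes odd_l: "odd l" and root: "primitive_root_of_unity l u"
begin

text \<open>The additive character of the integers modulo \<open>l\<close>, taken on integer
  representatives; \<open>e_cong\<close> below is its well-definedness on residues.\<close>

definition e :: "int \<Rightarrow> complex" where "e m = u powi m"

abbreviation "I \<equiv> {0..<int l}"
abbreviation "C \<equiv> coord_space I"

lemma l_pos [simp]: "0 < l"
  using root by (simp add: primitive_root_of_unity_def)

lemma l_nz [simp]: "l \<noteq> 0"
  using l_pos by (rule gr_implies_not0)

lemma u_nz [simp]: "u \<noteq> 0"
proof
  assume "u = 0"
  then have "u ^ l = 0" by (simp add: zero_power)
  then show False using root unfolding primitive_root_of_unity_def by (metis zero_neq_one)
qed

section \<open>The character \<open>e\<close> and its orthogonality relation\<close>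

lemma e_0 [simp]: "e 0 = 1" by (simp add: e_def)
lemma e_nz [simp]: "e m \<noteq> 0" by (simp add: e_def)
lemma e_add: "e (m + n) = e m * e n" by (simp add: e_def power_int_add)

lemma e_multiple [simp]: "e (int l * k) = 1"
  using root by (simp add: e_def power_int_mult primitive_root_of_unity_def)

lemma e_cong: "int l dvd m - n \<Longrightarrow> e m = e n"
  using e_add [of n "m - n"] by (auto elim!: dvdE)

lemma e_eq_1_iff: "e m = 1 \<longleftrightarrow> int l dvd m"
proof
  assume "e m = 1"
  then have "e (m mod int l) = 1" using e_cong [of "m mod int l" m] by (simp add: mod_eq_dvd_iff [symmetric])
  moreover have "m mod int l = int (nat (m mod int l))" by simp
  ultimately have "u ^ nat (m mod int l) = 1" by (metis e_def power_int_of_nat)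
  moreover have "nat (m mod int l) < l" by (simp add: nat_less_iff)
  ultimately have "nat (m mod int l) = 0"
    using root by (metis gr0I primitive_root_of_unity_def)
  moreover have "0 \<le> m mod int l" by simp
  ultimately have "m mod int l = 0" by linarith
  then show "int l dvd m" by (simp only: mod_eq_0_iff_dvd)
next
  assume "int l dvd m"
  then show "e m = 1" using e_cong [of m 0] by simp
qed

text \<open>As \<open>l\<close> is odd, 2 is invertible modulo \<open>l\<close>, so the factor 2 in
  the polar form \<open>2 x y\<close> costs no nondegeneracy.\<close>

lemma dvd_double_iff: "int l dvd 2 * m \<longleftrightarrow> int l dvd m"
  using odd_l by (simp add: coprime_dvd_mult_right_iff coprime_right_2_iff_odd)

lemma dvd_in_I: "x \<in> I \<Longrightarrow> int l dvd x \<longleftrightarrow> x = 0"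
  using zdvd_not_zless by force

lemma sum_shift: "(\<Sum>x\<in>I. F ((x + a) mod int l)) = sum F I"
  by (rule sum.reindex_bij_witness [of _ "\<lambda>x. (x - a) mod int l" "\<lambda>x. (x + a) mod int l"])
    (auto simp: mod_simps)

lemma sum_neg: "(\<Sum>x\<in>I. F ((- x) mod int l)) = sum F I"
  by (rule sum.reindex_bij_witness [of _ "\<lambda>x. (- x) mod int l" "\<lambda>x. (- x) mod int l"])
    (auto simp: mod_simps)

text \<open>Shifting the summation variable by 1 multiplies the sum by \<open>e (2 * d)\<close>,
  which differs from 1 unless \<open>l\<close> divides \<open>d\<close>.\<close>

lemma sum_e: "(\<Sum>y\<in>I. e (2 * d * y)) = (if int l dvd d then of_nat l else 0)"
proof (cases "int l dvd d")
  case True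
  then have "e (2 * d * y) = 1" for y by (simp add: e_eq_1_iff)
  then show ?thesis using True by simp
next
  case False
  have "e (2 * d * ((y + 1) mod int l)) = e (2 * d) * e (2 * d * y)" for y
    unfolding e_add [symmetric]
  proof (rule e_cong)
    have "2 * d * ((y + 1) mod int l) mod int l = 2 * d * (y + 1) mod int l"
      by (rule mod_mult_right_eq)
    also have "2 * d * (y + 1) = 2 * d + 2 * d * y" by (simp add: algebra_simps)
    finally show "int l dvd 2 * d * ((y + 1) mod int l) - (2 * d + 2 * d * y)"
      by (simp only: mod_eq_dvd_iff)
  qed
  then have "(\<Sum>y\<in>I. e (2 * d * y)) = e (2 * d) * (\<Sum>y\<in>I. e (2 * d * y))"
    using sum_shift [of "\<lambda>y. e (2 * d * y)" 1] by (simp add: sum_distrib_left)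
  moreover have "e (2 * d) \<noteq> 1" using False by (simp add: e_eq_1_iff dvd_double_iff)
  ultimately show ?thesis using False by simp
qed

text \<open>\<open>S\<close> and \<open>T\<close> are the matrices of the pointed category written
  with \<open>e\<close>; \<open>quadratic_form_exists\<close> identifies them with
  \<open>pointed_S\<close> and \<open>pointed_T\<close>.\<close>

definition S :: "int \<Rightarrow> int \<Rightarrow> complex" where "S x y = e (- (2 * x * y))"
definition T :: "int \<Rightarrow> int \<Rightarrow> complex" where "T x y = (if x = y then e (x\<^sup>2) else 0)"

lemma S_apply: "x \<in> I \<Longrightarrow> mat_act I S f x = (\<Sum>y\<in>I. e (- (2 * x * y)) * f y)"
  by (simp add: mat_act_def S_def)

lemma T_apply: "x \<in> I \<Longrightarrow> mat_act I T f x = e (x\<^sup>2) * f x"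
  by (simp add: mat_act_def T_def if_distrib [of "\<lambda>c. c * _"] cong: if_cong)

section \<open>Heisenberg-Weyl operators and their intertwiners\<close>

lemma mod_I [simp]: "x mod int l \<in> I"
  by simp

text \<open>A translation by \<open>v $ 2\<close> combined with a modulation by
  \<open>v $ 1\<close>. The exponent is the mean of those for the two orders of composition; with
  this choice \<open>S\<close> and \<open>T\<close> act on the parameter \<open>v\<close> exactly,
  without extra phases.\<close>

definition weyl :: "int^2 \<Rightarrow> (int \<Rightarrow> complex) \<Rightarrow> (int \<Rightarrow> complex)"
  where "weyl v f =
    (\<lambda>z. if z \<in> I then e (2 * v $ 1 * z - v $ 1 * v $ 2) * f ((z - v $ 2) mod int l) else 0)"

lemma weyl_in_C: "weyl v f \<in> C"
  by (simp add: weyl_def coord_space_def)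

lemma weyl_cscale: "weyl v (cscale c f) = cscale c (weyl v f)"
  by (auto simp: weyl_def cscale_def)

text \<open>The characteristic property of a Weil operator of \<open>g\<close>, kept as a predicate
  so that no formula for general \<open>g\<close> is needed.\<close>

definition intertwiner :: "int^2^2 \<Rightarrow> ((int \<Rightarrow> complex) \<Rightarrow> (int \<Rightarrow> complex)) \<Rightarrow> bool"
  where "intertwiner g X \<longleftrightarrow> Vector_Spaces.linear cscale cscale X \<and> bij_betw X C C \<and>
    (\<forall>v. \<forall>f\<in>C. X (weyl v f) = weyl (g *v v) (X f))"

lemma intertwiner_one: "intertwiner (mat 1) id"
  by (auto simp: intertwiner_def intro: cfun_linearI)

lemma intertwiner_compose:
  assumes "intertwiner g X" "intertwiner g' Y"
  shows "intertwiner (g ** g') (X \<circ> Y)"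
  using assms Vector_Spaces.linear_compose [of cscale cscale Y cscale X]
    bij_betw_trans [of Y C C X C]
  by (auto simp: intertwiner_def matrix_vector_mul_assoc [symmetric] dest: bij_betw_apply)

lemma in_C_eqI: "f \<in> C \<Longrightarrow> g \<in> C \<Longrightarrow> (\<And>x. x \<in> I \<Longrightarrow> f x = g x) \<Longrightarrow> f = g"
  by (rule ext) (metis (mono_tags, lifting) coord_space_def mem_Collect_eq)

text \<open>Fourier inversion: the kernel with opposite exponent, divided by \<open>l\<close>, is a
  two-sided inverse by \<open>sum_e\<close>.\<close>

lemma S_bij: "bij_betw (mat_act I S) C C"
proof -
  define S' where "S' x y = e (2 * x * y) / of_nat l" for x y
  have inv: "mat_act I P (mat_act I R f) = f" if f: "f \<in> C"
    and PR: "\<And>x z. x \<in> I \<Longrightarrow> z \<in> I \<Longrightarrow> (\<Sum>y\<in>I. P x y * R y z) = (if x = z then 1 else 0)" for P R f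
  proof (rule in_C_eqI)
    fix x assume x: "x \<in> I"
    have "mat_act I P (mat_act I R f) x = (\<Sum>y\<in>I. \<Sum>z\<in>I. P x y * R y z * f z)"
      using x by (simp add: mat_act_def sum_distrib_left mult.assoc)
    also have "\<dots> = (\<Sum>z\<in>I. (\<Sum>y\<in>I. P x y * R y z) * f z)"
      by (subst sum.swap) (simp add: sum_distrib_right)
    also have "\<dots> = (\<Sum>z\<in>I. if x = z then f z else 0)"
      using x PR by (intro sum.cong) auto
    also have "\<dots> = f x" using x by simp
    finally show "mat_act I P (mat_act I R f) x = f x" .
  qed (use f mat_act_in_coord_space in auto)
  have eq: "int l dvd x - z \<longleftrightarrow> x = z" if "x \<in> I" "z \<in> I" for x z
    using that by (metis atLeastLessThan_iff mod_eq_dvd_iff mod_pos_pos_trivial)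
  have "(\<Sum>y\<in>I. S x y * S' y z) = (if x = z then 1 else 0)" if "x \<in> I" "z \<in> I" for x z
  proof -
    have "(\<Sum>y\<in>I. S x y * S' y z) = (\<Sum>y\<in>I. e (2 * (z - x) * y)) / of_nat l"
      unfolding sum_divide_distrib S_def S'_def
      by (rule sum.cong) (simp_all add: algebra_simps flip: e_add)
    then show ?thesis using eq [OF that(2,1)] by (auto simp only: sum_e) simp_all
  qed
  moreover have "(\<Sum>y\<in>I. S' x y * S y z) = (if x = z then 1 else 0)" if "x \<in> I" "z \<in> I" for x z
  proof -
    have "(\<Sum>y\<in>I. S' x y * S y z) = (\<Sum>y\<in>I. e (2 * (x - z) * y)) / of_nat l"
      unfolding sum_divide_distrib S_def S'_def
      by (rule sum.cong) (simp_all add: algebra_simps flip: e_add)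
    then show ?thesis using eq [OF that] by (auto simp only: sum_e) simp_all
  qed
  ultimately show ?thesis
    by (intro bij_betw_byWitness [where f' = "mat_act I S'"])
      (auto simp: inv mat_act_in_coord_space simp del: atLeastLessThan_iff)
qed

lemma T_bij: "bij_betw (mat_act I T) C C"
proof -
  define T' where "T' x y = (if x = y then 1 / e (x\<^sup>2) else 0)" for x y :: int
  have T': "mat_act I T' f x = f x / e (x\<^sup>2)" if "x \<in> I" for f x
    using that by (simp add: mat_act_def T'_def if_distrib [of "\<lambda>c. c * _"] cong: if_cong)
  show ?thesis
    by (intro bij_betw_byWitness [where f' = "mat_act I T'"] ballI in_C_eqI)
      (auto simp: mat_act_in_coord_space T_apply T' simp del: atLeastLessThan_iff)
qed

lemma gen_s_vec: "(gen_s *v v) $ 1 = - v $ 2" "(gen_s *v v) $ 2 = v $ 1"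
  and gen_t_vec: "(gen_t *v v) $ 1 = v $ 1 + v $ 2" "(gen_t *v v) $ 2 = v $ 2"
  by (simp_all add: gen_s_mat2 gen_t_mat2 matrix_vector_mult_def sum_2)

text \<open>The Fourier transform turns modulations into translations and translations into inverse
  modulations, which is the action of \<open>gen_s\<close> on the parameters.\<close>

lemma intertwiner_s: "intertwiner gen_s (mat_act I S)"
  unfolding intertwiner_def
proof (intro conjI allI ballI mat_act_linear S_bij)
  fix v f assume f: "f \<in> C"
  show "mat_act I S (weyl v f) = weyl (gen_s *v v) (mat_act I S f)"
  proof (rule in_C_eqI)
    fix x assume x: "x \<in> I"
    let ?F = "\<lambda>y. e (- (2 * x * y)) * (e (2 * v $ 1 * y - v $ 1 * v $ 2) * f ((y - v $ 2) mod int l))"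
    have "mat_act I S (weyl v f) x = sum ?F I"
      unfolding S_apply [OF x] by (rule sum.cong) (simp_all add: weyl_def)
    \<comment> \<open>The reindexing undoes the translation inside \<open>weyl v\<close>; what
      remains is a comparison of exponents modulo \<open>l\<close>.\<close>
    also have "\<dots> = (\<Sum>y\<in>I. ?F ((y + v $ 2) mod int l))"
      by (rule sum_shift [symmetric])
    also have "\<dots> = (\<Sum>y\<in>I. e (- (2 * v $ 2 * x) + v $ 2 * v $ 1) *
        (e (- (2 * ((x - v $ 1) mod int l) * y)) * f y))"
    proof (rule sum.cong)
      fix y assume y: "y \<in> I"
      have "e (- (2 * x * ((y + v $ 2) mod int l)) +
            (2 * v $ 1 * ((y + v $ 2) mod int l) - v $ 1 * v $ 2))
          = e (- (2 * v $ 2 * x) + v $ 2 * v $ 1 + - (2 * ((x - v $ 1) mod int l) * y))"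
      proof (rule e_cong)
        have "(- (2 * x * ((y + v $ 2) mod int l)) + (2 * v $ 1 * ((y + v $ 2) mod int l) - v $ 1 * v $ 2))
            mod int l = (- (2 * x * (y + v $ 2)) + (2 * v $ 1 * (y + v $ 2) - v $ 1 * v $ 2)) mod int l"
          by (intro mod_diff_cong mod_add_cong mod_minus_cong mod_mult_cong) auto
        also have "\<dots> = (- (2 * v $ 2 * x) + v $ 2 * v $ 1 + - (2 * (x - v $ 1) * y)) mod int l"
          by (simp add: algebra_simps)
        also have "\<dots> = (- (2 * v $ 2 * x) + v $ 2 * v $ 1 + - (2 * ((x - v $ 1) mod int l) * y)) mod int l"
          by (intro mod_diff_cong mod_add_cong mod_minus_cong mod_mult_cong) auto
        finally show "int l dvd - (2 * x * ((y + v $ 2) mod int l)) +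
            (2 * v $ 1 * ((y + v $ 2) mod int l) - v $ 1 * v $ 2) -
            (- (2 * v $ 2 * x) + v $ 2 * v $ 1 + - (2 * ((x - v $ 1) mod int l) * y))"
          by (simp only: mod_eq_dvd_iff)
      qed
      moreover have "((y + v $ 2) mod int l - v $ 2) mod int l = y"
        using y by (simp add: mod_simps)
      ultimately show "?F ((y + v $ 2) mod int l) = e (- (2 * v $ 2 * x) + v $ 2 * v $ 1) *
          (e (- (2 * ((x - v $ 1) mod int l) * y)) * f y)"
        by (simp only: e_add mult.assoc [symmetric])
    qed simp
    also have "\<dots> = weyl (gen_s *v v) (mat_act I S f) x"
      using x S_apply [OF mod_I [of "x - v $ 1"], of f]
      by (simp add: weyl_def gen_s_vec sum_distrib_left)
    finally show "mat_act I S (weyl v f) x = weyl (gen_s *v v) (mat_act I S f) x" .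
  qed (use weyl_in_C mat_act_in_coord_space in auto)
qed

text \<open>Multiplication by \<open>e (x^2)\<close> commutes with modulations. Since
  \<open>x^2 - (x - b)^2 = 2 b x - b^2\<close>, it adds a modulation by \<open>b\<close> to a
  translation by \<open>b\<close>.\<close>

lemma intertwiner_t: "intertwiner gen_t (mat_act I T)"
  unfolding intertwiner_def
proof (intro conjI allI ballI mat_act_linear T_bij)
  fix v f assume f: "f \<in> C"
  show "mat_act I T (weyl v f) = weyl (gen_t *v v) (mat_act I T f)"
  proof (rule in_C_eqI)
    fix x assume x: "x \<in> I"
    have exps: "e (x\<^sup>2 + (2 * v $ 1 * x - v $ 1 * v $ 2)) =
        e (2 * (v $ 1 + v $ 2) * x - (v $ 1 + v $ 2) * v $ 2 + ((x - v $ 2) mod int l)\<^sup>2)"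
    proof (rule e_cong)
      have "(x\<^sup>2 + (2 * v $ 1 * x - v $ 1 * v $ 2)) mod int l =
          (2 * (v $ 1 + v $ 2) * x - (v $ 1 + v $ 2) * v $ 2 + (x - v $ 2)\<^sup>2) mod int l"
        by (simp add: algebra_simps power2_eq_square)
      also have "\<dots> = (2 * (v $ 1 + v $ 2) * x - (v $ 1 + v $ 2) * v $ 2 +
          ((x - v $ 2) mod int l)\<^sup>2) mod int l"
        by (intro mod_add_cong) (simp_all add: power_mod)
      finally show "int l dvd x\<^sup>2 + (2 * v $ 1 * x - v $ 1 * v $ 2) -
          (2 * (v $ 1 + v $ 2) * x - (v $ 1 + v $ 2) * v $ 2 + ((x - v $ 2) mod int l)\<^sup>2)"
        by (simp only: mod_eq_dvd_iff)
    qed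
    have lhs: "mat_act I T (weyl v f) x =
        e (x\<^sup>2) * (e (2 * v $ 1 * x - v $ 1 * v $ 2) * f ((x - v $ 2) mod int l))"
      using x by (simp add: T_apply weyl_def)
    have rhs: "weyl (gen_t *v v) (mat_act I T f) x =
        e (2 * (v $ 1 + v $ 2) * x - (v $ 1 + v $ 2) * v $ 2) *
        (e (((x - v $ 2) mod int l)\<^sup>2) * f ((x - v $ 2) mod int l))"
      using x by (simp only: weyl_def gen_t_vec if_True T_apply [OF mod_I])
    show "mat_act I T (weyl v f) x = weyl (gen_t *v v) (mat_act I T f) x"
      unfolding lhs rhs mult.assoc [symmetric] e_add [symmetric] exps ..
  qed (use weyl_in_C mat_act_in_coord_space in auto)
qed

lemma intertwiner_exists: "g \<in> SL2Z \<Longrightarrow> \<exists>X. intertwiner g X"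
  by (induction rule: SL2Z_induct)
    (use intertwiner_one intertwiner_s intertwiner_t intertwiner_compose in blast)+

section \<open>Uniqueness of intertwiners up to a scalar\<close>

definition delta :: "int \<Rightarrow> int \<Rightarrow> complex" where "delta a = (\<lambda>z. if z = a then 1 else 0)"

lemma delta_in_C: "a \<in> I \<Longrightarrow> delta a \<in> C"
  by (auto simp: delta_def coord_space_def)

lemma C_expand: "f \<in> C \<Longrightarrow> f = (\<Sum>a\<in>I. cscale (f a) (delta a))"
  by (rule ext) (auto simp: sum_fun_eval cscale_def delta_def coord_space_def
      if_distrib [of "\<lambda>c. _ * c"] cong: if_cong)

text \<open>The modulations determine \<open>delta 0\<close> up to a scalar as a common fixed vector, and the
  translations move it to the other basis vectors.\<close>

lemma intertwiner_unique:
  assumes X: "intertwiner g X" and Y: "intertwiner g Y"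
  shows "eq_up_to_scalar C Y X"
proof -
  define m :: "int^2" where "m = vector [1, 0]"
  have m [simp]: "m $ 1 = 1" "m $ 2 = 0" by (simp_all add: m_def)
  interpret X: Vector_Spaces.linear cscale cscale X using X by (simp add: intertwiner_def)
  interpret Y: Vector_Spaces.linear cscale cscale Y using Y by (simp add: intertwiner_def)
  have Xb: "bij_betw X C C" and Yb: "bij_betw Y C C" using X Y by (auto simp: intertwiner_def)
  have Xw: "X (weyl v f) = weyl (g *v v) (X f)" and Yw: "Y (weyl v f) = weyl (g *v v) (Y f)"
    if "f \<in> C" for v f using X Y that by (auto simp: intertwiner_def)
  have d0: "delta 0 \<in> C" by (simp add: delta_in_C)
  have "Y (delta 0) \<in> X ` C" using Xb Yb d0 by (auto simp: bij_betw_def)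
  then obtain f where f: "f \<in> C" "Y (delta 0) = X f" by auto
  \<comment> \<open>Both \<open>X\<close> and \<open>Y\<close> carry \<open>weyl m\<close> to
    \<open>weyl (g *v m)\<close>, so the preimage \<open>f\<close> is fixed by \<open>weyl m\<close>
    just as \<open>delta 0\<close> is. A fixed vector vanishes wherever \<open>e (2 * z)\<close> is
    not 1, that is, away from 0.\<close>
  have "weyl m (delta 0) = delta 0" by (auto simp: weyl_def delta_def)
  then have "X (weyl m f) = X f" using Xw [OF f(1), of m] Yw [OF d0, of m] f(2) by simp
  then have fixed: "weyl m f = f"
    using inj_onD [OF bij_betw_imp_inj_on [OF Xb]] weyl_in_C f(1) by blast
  define c where "c = f 0"
  have "f = cscale c (delta 0)"
  proof (rule in_C_eqI)
    fix z assume z: "z \<in> I"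
    have "e (2 * z) * f z = f z" using fun_cong [OF fixed, of z] z by (simp add: weyl_def)
    then have "f z = 0" if "z \<noteq> 0"
      using that dvd_in_I [OF z] e_eq_1_iff [of "2 * z"] by (simp add: dvd_double_iff)
    then show "f z = cscale c (delta 0) z" by (auto simp: cscale_def delta_def c_def)
  qed (use f d0 cfun.subspace_scale [OF coord_space_subspace] in auto)
  then have Y0: "Y (delta 0) = cscale c (X (delta 0))" using f(2) by (simp add: X.scale)
  have "c \<noteq> 0"
  proof
    assume "c = 0"
    then have "Y (delta 0) = Y 0" using Y0 by (simp only: cfun.scale_zero_left Y.zero)
    then have "delta 0 = 0"
      using inj_onD [OF bij_betw_imp_inj_on [OF Yb]] d0 cfun.subspace_0 [OF coord_space_subspace] by blast
    then show False by (metis delta_def zero_fun_apply zero_neq_one)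
  qed
  have basis: "Y (delta a) = cscale c (X (delta a))" if a: "a \<in> I" for a
  proof -
    \<comment> \<open>Translation by \<open>a\<close> also has the same image under \<open>X\<close>
      and \<open>Y\<close>, so the scalar \<open>c\<close> found at 0 serves every basis
      vector.\<close>
    define t :: "int^2" where "t = vector [0, a]"
    have t: "weyl t (delta 0) = delta a"
    proof (rule in_C_eqI)
      fix z assume "z \<in> I"
      moreover from this a have "(z - a) mod int l = 0 \<longleftrightarrow> z = a"
        by (metis atLeastLessThan_iff mod_0 mod_eq_dvd_iff mod_pos_pos_trivial diff_zero)
      ultimately show "weyl t (delta 0) z = delta a z" by (simp add: weyl_def t_def delta_def)
    qed (use a weyl_in_C delta_in_C in auto)
    show ?thesis using Xw [OF d0, of t] Yw [OF d0, of t] by (simp add: t Y0 weyl_cscale)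
  qed
  have "Y f = cscale c (X f)" if f: "f \<in> C" for f
  proof -
    have "Y f = (\<Sum>a\<in>I. cscale (f a) (Y (delta a)))"
      by (subst C_expand [OF f]) (simp add: Y.sum Y.scale)
    also have "\<dots> = (\<Sum>a\<in>I. cscale c (cscale (f a) (X (delta a))))"
      by (rule sum.cong) (simp_all add: basis mult.commute)
    also have "\<dots> = cscale c (X (\<Sum>a\<in>I. cscale (f a) (delta a)))"
      by (simp only: X.sum X.scale cfun.scale_sum_right)
    finally show ?thesis using C_expand [OF f] by simp
  qed
  with \<open>c \<noteq> 0\<close> show ?thesis unfolding eq_up_to_scalar_def by blast
qed

definition weil :: "int proj_action" where "weil g = (SOME X. intertwiner g X)"

lemma intertwiner_weil: "g \<in> SL2Z \<Longrightarrow> intertwiner g (weil g)"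
  unfolding weil_def using intertwiner_exists by (rule someI_ex)

text \<open>\<open>weil (g ** g')\<close> and \<open>weil g \<circ> weil g'\<close> intertwine for
  the same matrix, so they agree up to a scalar; the same argument compares \<open>weil\<close> with
  \<open>S\<close> and \<open>T\<close> at the generators.\<close>

lemma weil_rep: "projective_rep_by_matrices I S T weil"
proof -
  have "eq_up_to_scalar C (weil (g ** g')) (weil g \<circ> weil g')" if "g \<in> SL2Z" "g' \<in> SL2Z" for g g'
    by (rule intertwiner_unique [of "g ** g'"])
      (use that in \<open>auto intro: intertwiner_compose intertwiner_weil SL2Z_mult\<close>)
  moreover have "Vector_Spaces.linear cscale cscale (weil g) \<and> bij_betw (weil g) C C"
    if "g \<in> SL2Z" for g using intertwiner_weil [OF that] by (auto simp: intertwiner_def)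
  ultimately show ?thesis
    unfolding projective_rep_by_matrices_def projective_rep_def
    using coord_space_subspace intertwiner_unique [OF intertwiner_s intertwiner_weil]
      intertwiner_unique [OF intertwiner_t intertwiner_weil] by auto
qed

end

section \<open>The parity decomposition\<close>

context odd_root
begin

definition parity_part :: "complex \<Rightarrow> (int \<Rightarrow> complex) set"
  where "parity_part \<epsilon> = {v \<in> C. \<forall>x\<in>I. v ((- x) mod int l) = \<epsilon> * v x}"

lemma parity_part_subspace: "cfun.subspace (parity_part \<epsilon>)"
  using coord_space_subspace [of I]
  by (auto simp: cfun.subspace_def parity_part_def cscale_def distrib_left)

text \<open>Reindexing the sum by negation moves the reflection from the row index of
  \<open>A\<close> to the argument of \<open>v\<close>.\<close>

lemma mat_act_parity:
  assumes A: "\<And>x y. x \<in> I \<Longrightarrow> y \<in> I \<Longrightarrow> A ((- x) mod int l) ((- y) mod int l) = A x y"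
    and v: "v \<in> parity_part \<epsilon>"
  shows "mat_act I A v \<in> parity_part \<epsilon>"
proof -
  have "mat_act I A v ((- x) mod int l) = \<epsilon> * mat_act I A v x" if x: "x \<in> I" for x
  proof -
    have "mat_act I A v ((- x) mod int l) =
        (\<Sum>y\<in>I. A ((- x) mod int l) ((- y) mod int l) * v ((- y) mod int l))"
      by (simp add: mat_act_def sum_neg [of "\<lambda>y. A ((- x) mod int l) y * v y"])
    also have "\<dots> = (\<Sum>y\<in>I. \<epsilon> * (A x y * v y))"
      using x v by (intro sum.cong) (simp_all add: A parity_part_def)
    finally show ?thesis using x by (simp add: mat_act_def sum_distrib_left)
  qed
  then show ?thesis by (simp add: parity_part_def mat_act_in_coord_space)
qed

lemma S_parity: "v \<in> parity_part \<epsilon> \<Longrightarrow> mat_act I S v \<in> parity_part \<epsilon>"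
proof (rule mat_act_parity)
  fix x y
  show "S ((- x) mod int l) ((- y) mod int l) = S x y"
    unfolding S_def
  proof (rule e_cong)
    have "- (2 * ((- x) mod int l) * ((- y) mod int l)) mod int l = - (2 * (- x) * (- y)) mod int l"
      by (intro mod_minus_cong mod_mult_cong) auto
    then show "int l dvd - (2 * ((- x) mod int l) * ((- y) mod int l)) - - (2 * x * y)"
      by (simp only: mod_eq_dvd_iff mult_minus_left mult_minus_right minus_minus)
  qed
qed

lemma T_parity: "v \<in> parity_part \<epsilon> \<Longrightarrow> mat_act I T v \<in> parity_part \<epsilon>"
proof (rule mat_act_parity)
  fix x y assume xy: "x \<in> I" "y \<in> I"
  have "(- x) mod int l = (- y) mod int l \<longleftrightarrow> x = y"
    using xy by (metis atLeastLessThan_iff minus_minus mod_minus_cong mod_pos_pos_trivial)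
  moreover have "e (((- z) mod int l)\<^sup>2) = e (z\<^sup>2)" for z
    by (rule e_cong) (simp add: power_mod flip: mod_eq_dvd_iff)
  ultimately show "T ((- x) mod int l) ((- y) mod int l) = T x y" by (simp add: T_def)
qed

lemma parity_direct_sum: "direct_sum_of C (parity_part 1) (parity_part (- 1))"
proof -
  have "v \<in> {a + b |a b. a \<in> parity_part 1 \<and> b \<in> parity_part (- 1)}" if v: "v \<in> C" for v
  proof -
    \<comment> \<open>The reflection of \<open>v\<close>, cut off outside \<open>I\<close> so that
      the even and odd halves of \<open>v\<close> stay in \<open>C\<close>.\<close>
    define r where "r x = (if x \<in> I then v ((- x) mod int l) else 0)" for x
    have "(\<lambda>x. (v x + r x) / 2) \<in> parity_part 1" "(\<lambda>x. (v x - r x) / 2) \<in> parity_part (- 1)"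
      using v by (auto simp: parity_part_def coord_space_def r_def mod_simps field_simps)
    moreover have "v = (\<lambda>x. (v x + r x) / 2) + (\<lambda>x. (v x - r x) / 2)"
      by (auto simp: fun_eq_iff field_simps)
    ultimately show ?thesis by blast
  qed
  moreover have "a + b \<in> C" if "a \<in> parity_part 1" "b \<in> parity_part (- 1)" for a b
    using that coord_space_subspace [of I] by (auto simp: cfun.subspace_def parity_part_def)
  moreover have "v = 0" if v: "v \<in> parity_part 1" "v \<in> parity_part (- 1)" for v
  proof (rule in_C_eqI)
    fix x assume "x \<in> I"
    then have "v x = - v x" using v by (simp add: parity_part_def)
    then show "v x = 0 x" by simp
  qed (use v in \<open>auto simp: parity_part_def coord_space_def\<close>)
  ultimately show ?thesis
    using parity_part_subspace cfun.subspace_0 [OF parity_part_subspace]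
    by (auto simp: direct_sum_of_def)
qed

section \<open>Coordinates on the parity parts\<close>

definition half :: nat where "half = l div 2"

lemma l_half: "l = 2 * half + 1"
  using odd_l by (simp add: half_def)

text \<open>Representatives of the orbits of negation at which a function of the given parity is
  unconstrained: odd functions vanish at 0, so 0 is left out for them.\<close>

definition reps :: "complex \<Rightarrow> nat set"
  where "reps \<epsilon> = (if \<epsilon> = 1 then {0..half} else {1..half})"

lemma finite_reps [simp]: "finite (reps \<epsilon>)"
  by (simp add: reps_def)

text \<open>A function of given parity is determined by its values on \<open>reps\<close>; the weights \<open>c\<close> account
  for the normalisation of the basis.\<close>

definition to_reps :: "complex \<Rightarrow> (nat \<Rightarrow> complex) \<Rightarrow> (int \<Rightarrow> complex) \<Rightarrow> nat \<Rightarrow> complex"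
  where "to_reps \<epsilon> c v = (\<lambda>r. if r \<in> reps \<epsilon> then c r * v (int r) else 0)"

text \<open>Arguments above \<open>half\<close> are filled in by parity from \<open>l - x\<close>.
  In the odd case the value at 0 is \<open>w 0 / c 0\<close>, which is 0 for \<open>w\<close>
  supported on \<open>reps (- 1)\<close>.\<close>

definition from_reps :: "complex \<Rightarrow> (nat \<Rightarrow> complex) \<Rightarrow> (nat \<Rightarrow> complex) \<Rightarrow> int \<Rightarrow> complex"
  where "from_reps \<epsilon> c w = (\<lambda>x. if x \<in> I then
     if x \<le> int half then w (nat x) / c (nat x)
     else \<epsilon> * (w (nat (int l - x)) / c (nat (int l - x))) else 0)"

lemma to_reps_linear: "Vector_Spaces.linear cscale cscale (to_reps \<epsilon> c)"
  by (rule cfun_linearI) (auto simp: to_reps_def cscale_def fun_eq_iff algebra_simps)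

lemma from_reps_linear: "Vector_Spaces.linear cscale cscale (from_reps \<epsilon> c)"
  by (rule cfun_linearI)
    (auto simp: from_reps_def cscale_def fun_eq_iff algebra_simps add_divide_distrib)

lemma neg_mod: "x \<in> I \<Longrightarrow> (- x) mod int l = (if x = 0 then 0 else int l - x)"
  by (simp add: zmod_zminus1_eq_if)

lemma parity_neg:
  assumes "v \<in> parity_part \<epsilon>" "x \<in> I" "x \<noteq> 0"
  shows "v (int l - x) = \<epsilon> * v x"
proof -
  have "v ((- x) mod int l) = \<epsilon> * v x" using assms by (simp add: parity_part_def)
  then show ?thesis using assms by (simp only: neg_mod if_False)
qed

lemma parity_zero: "v \<in> parity_part (- 1) \<Longrightarrow> v 0 = 0"
  by (auto simp: parity_part_def dest: bspec [of _ _ 0])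

lemma from_to_reps:
  assumes "\<epsilon> = 1 \<or> \<epsilon> = - 1" and c: "\<And>r. c r \<noteq> 0" and v: "v \<in> parity_part \<epsilon>"
  shows "from_reps \<epsilon> c (to_reps \<epsilon> c v) = v"
proof (rule in_C_eqI)
  fix x assume x: "x \<in> I"
  have v0: "v 0 = 0" if "\<epsilon> \<noteq> 1" using that assms(1) v parity_zero by auto
  show "from_reps \<epsilon> c (to_reps \<epsilon> c v) x = v x"
  proof (cases "x \<le> int half")
    case True
    \<comment> \<open>In the odd case 0 is not a representative; there both sides vanish, by
      \<open>v0\<close>.\<close>
    then have "nat x \<in> reps \<epsilon> \<or> (\<epsilon> \<noteq> 1 \<and> x = 0)" using x by (auto simp: reps_def)
    then show ?thesis using x True v0 c by (auto simp: from_reps_def to_reps_def reps_def)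
  next
    case False
    then have "nat (int l - x) \<in> reps \<epsilon>" using x l_half by (auto simp: reps_def)
    then have "from_reps \<epsilon> c (to_reps \<epsilon> c v) x = \<epsilon> * v (int l - x)"
      using x False c by (simp add: from_reps_def to_reps_def)
    also have "\<dots> = \<epsilon> * (\<epsilon> * v x)" using parity_neg [OF v x] False by auto
    also have "\<dots> = v x" using assms(1) by auto
    finally show ?thesis .
  qed
qed (use v in \<open>auto simp: parity_part_def from_reps_def coord_space_def\<close>)

lemma to_reps_bij:
  assumes \<epsilon>: "\<epsilon> = 1 \<or> \<epsilon> = - 1" and c: "\<And>r. c r \<noteq> 0"
  shows "bij_betw (to_reps \<epsilon> c) (parity_part \<epsilon>) (coord_space (reps \<epsilon>))"
proof (rule bij_betw_byWitness [where f' = "from_reps \<epsilon> c"])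
  show "\<forall>v\<in>parity_part \<epsilon>. from_reps \<epsilon> c (to_reps \<epsilon> c v) = v"
    using from_to_reps [of \<epsilon> c] \<epsilon> c by blast
  show "\<forall>w\<in>coord_space (reps \<epsilon>). to_reps \<epsilon> c (from_reps \<epsilon> c w) = w"
    using l_half c by (auto simp: to_reps_def from_reps_def coord_space_def reps_def fun_eq_iff)
  show "to_reps \<epsilon> c ` parity_part \<epsilon> \<subseteq> coord_space (reps \<epsilon>)"
    by (auto simp: to_reps_def coord_space_def)
  have "from_reps \<epsilon> c w ((- x) mod int l) = \<epsilon> * from_reps \<epsilon> c w x"
    if w: "w \<in> coord_space (reps \<epsilon>)" and x: "x \<in> I" for w x
  proof -
    have w0: "w 0 = 0" if "\<epsilon> \<noteq> 1" using that w by (auto simp: coord_space_def reps_def)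
    have "x \<le> int half \<longleftrightarrow> \<not> int l - x \<le> int half" using l_half by linarith
    moreover have "\<epsilon> * (\<epsilon> * a) = a" for a using \<epsilon> by auto
    ultimately show ?thesis unfolding neg_mod [OF x] using x w0 \<epsilon>
      by (cases "x = 0") (auto simp: from_reps_def)
  qed
  then show "from_reps \<epsilon> c ` coord_space (reps \<epsilon>) \<subseteq> parity_part \<epsilon>"
    by (auto simp: parity_part_def from_reps_def [of _ _ _] coord_space_def)
qed

text \<open>Replacing \<open>r\<close> by \<open>l - r\<close> inverts the exponential and
  multiplies \<open>v\<close> by \<open>\<epsilon>\<close>, so the Fourier sum becomes a cosine sum
  on even functions and a sine sum on odd ones.\<close>

lemma S_fold:
  assumes v: "v \<in> parity_part \<epsilon>" and j: "j \<le> half"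
  shows "mat_act I S v (int j) =
    v 0 + (\<Sum>r\<in>{1..half}. (e (- (2 * int (j * r))) + \<epsilon> * e (2 * int (j * r))) * v (int r))"
proof -
  have jI: "int j \<in> I" using j l_half by simp
  have "mat_act I S v (int j) = (\<Sum>y\<in>I. e (- (2 * int j * y)) * v y)" by (rule S_apply [OF jI])
  also have "\<dots> = v 0 + (\<Sum>r\<in>{1..half}. e (- (2 * int j * int r)) * v (int r) +
      e (- (2 * int j * (int l - int r))) * v (int l - int r))"
    using sum_odd_range_fold [of "\<lambda>y. e (- (2 * int j * y)) * v y" half, folded l_half] by simp
  also have "(\<Sum>r\<in>{1..half}. e (- (2 * int j * int r)) * v (int r) +
      e (- (2 * int j * (int l - int r))) * v (int l - int r)) =
    (\<Sum>r\<in>{1..half}. (e (- (2 * int (j * r))) + \<epsilon> * e (2 * int (j * r))) * v (int r))"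
  proof (rule sum.cong)
    fix r assume r: "r \<in> {1..half}"
    have "v (int l - int r) = \<epsilon> * v (int r)"
      by (rule parity_neg [OF v]) (use r l_half in auto)
    moreover have "e (- (2 * int j * (int l - int r))) = e (2 * int (j * r))"
      by (rule e_cong) (simp add: algebra_simps)
    ultimately show "e (- (2 * int j * int r)) * v (int r) +
        e (- (2 * int j * (int l - int r))) * v (int l - int r) =
      (e (- (2 * int (j * r))) + \<epsilon> * e (2 * int (j * r))) * v (int r)"
      by (simp add: algebra_simps)
  qed simp
  finally show ?thesis .
qed

lemma u2_powers: "(u\<^sup>2) ^ n = e (2 * int n)" "(u\<^sup>2) powi (- int n) = e (- (2 * int n))"
proof -
  have "(u\<^sup>2) powi m = e (2 * m)" for m by (simp add: e_def power_int_mult)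
  from this [of "int n"] this [of "- int n"]
  show "(u\<^sup>2) ^ n = e (2 * int n)" "(u\<^sup>2) powi (- int n) = e (- (2 * int n))" by simp_all
qed

text \<open>The weight 2 produces the asymmetry of \<open>S_N\<close>: in row 0 it absorbs the
  factor 2 of the folded sum, and in the other rows it leaves a factor 2 in column 0.\<close>

abbreviation "even_weight r \<equiv> (if r = 0 then 1 else 2 :: complex)"

lemma S_even:
  "eq_up_to_scalar (parity_part 1) (to_reps 1 even_weight \<circ> mat_act I S)
     (mat_act {0..half} (S_N l (u\<^sup>2)) \<circ> to_reps 1 even_weight)"
proof -
  \<comment> \<open>\<open>S\<close> is not normalised, which accounts for the scalar
    \<open>sqrt l\<close>.\<close>
  define k where "k = complex_of_real (sqrt (real l))"
  have k: "k \<noteq> 0" by (simp add: k_def)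
  have "to_reps 1 even_weight (mat_act I S v) =
      cscale k (mat_act {0..half} (S_N l (u\<^sup>2)) (to_reps 1 even_weight v))"
    if v: "v \<in> parity_part 1" for v
  proof
    fix j
    show "to_reps 1 even_weight (mat_act I S v) j =
      cscale k (mat_act {0..half} (S_N l (u\<^sup>2)) (to_reps 1 even_weight v)) j"
    proof (cases "j \<le> half")
      case j: True
      have "cscale k (mat_act {0..half} (S_N l (u\<^sup>2)) (to_reps 1 even_weight v)) j =
          (\<Sum>r\<in>{0..half}. k * S_N l (u\<^sup>2) j r * (even_weight r * v (int r)))"
        using j by (simp add: cscale_def mat_act_def to_reps_def reps_def sum_distrib_left mult.assoc)
      also have "\<dots> = k * S_N l (u\<^sup>2) j 0 * v 0 +
          (\<Sum>r\<in>{1..half}. k * S_N l (u\<^sup>2) j r * (2 * v (int r)))"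
        unfolding sum.atLeast_Suc_atMost [OF le0]
        by (intro arg_cong2 [of _ _ _ _ "(+)"] sum.cong) auto
      also have "\<dots> = even_weight j * (v 0 +
          (\<Sum>r\<in>{1..half}. (e (- (2 * int (j * r))) + 1 * e (2 * int (j * r))) * v (int r)))"
        using k unfolding distrib_left sum_distrib_left S_N_def u2_powers k_def [symmetric]
        by (intro arg_cong2 [of _ _ _ _ "(+)"] sum.cong) (auto simp: algebra_simps)
      also have "\<dots> = to_reps 1 even_weight (mat_act I S v) j"
        unfolding S_fold [OF v j, symmetric] using j by (simp add: to_reps_def reps_def)
      finally show ?thesis ..
    qed (simp add: to_reps_def reps_def cscale_def mat_act_def)
  qed
  then show ?thesis using k unfolding eq_up_to_scalar_def comp_apply by blast
qed

text \<open>The kernel of \<open>S\<close> has exponent \<open>- 2 j r\<close>, so the sine sum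
  appears with the sign opposite to \<open>S_V\<close>; hence the scalar \<open>- k\<close>.\<close>

lemma S_odd:
  "eq_up_to_scalar (parity_part (- 1)) (to_reps (- 1) (\<lambda>_. 1) \<circ> mat_act I S)
     (mat_act {1..half} (S_V l (u\<^sup>2)) \<circ> to_reps (- 1) (\<lambda>_. 1))"
proof -
  define k where "k = complex_of_real (sqrt (real l))"
  have k: "k \<noteq> 0" by (simp add: k_def)
  have "to_reps (- 1) (\<lambda>_. 1) (mat_act I S v) =
      cscale (- k) (mat_act {1..half} (S_V l (u\<^sup>2)) (to_reps (- 1) (\<lambda>_. 1) v))"
    if v: "v \<in> parity_part (- 1)" for v
  proof
    fix j
    show "to_reps (- 1) (\<lambda>_. 1) (mat_act I S v) j =
      cscale (- k) (mat_act {1..half} (S_V l (u\<^sup>2)) (to_reps (- 1) (\<lambda>_. 1) v)) j"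
    proof (cases "j \<in> {1..half}")
      case j: True
      have "cscale (- k) (mat_act {1..half} (S_V l (u\<^sup>2)) (to_reps (- 1) (\<lambda>_. 1) v)) j =
          (\<Sum>r\<in>{1..half}. - k * S_V l (u\<^sup>2) j r * v (int r))"
        using j by (simp add: cscale_def mat_act_def to_reps_def reps_def sum_distrib_left mult.assoc
            sum_negf)
      also have "\<dots> = v 0 +
          (\<Sum>r\<in>{1..half}. (e (- (2 * int (j * r))) + - 1 * e (2 * int (j * r))) * v (int r))"
        using k parity_zero [OF v] unfolding S_V_def u2_powers k_def [symmetric]
        by (simp add: algebra_simps)
      also have "\<dots> = to_reps (- 1) (\<lambda>_. 1) (mat_act I S v) j"
        using S_fold [OF v, of j] j by (simp add: to_reps_def reps_def)
      finally show ?thesis ..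
    qed (auto simp: to_reps_def reps_def cscale_def mat_act_def)
  qed
  then show ?thesis using k unfolding eq_up_to_scalar_def comp_apply
    by (intro exI [of _ "- k"]) simp
qed

text \<open>\<open>j^2 - 1\<close> and \<open>j + 1\<close> have the same parity, so the two signs
  cancel; only the constant \<open>\<kappa> / u\<close> separates this entry from the one of
  \<open>T\<close>.\<close>

lemma T_diag_neg: "T_diag \<kappa> (- u) j j = \<kappa> / u * e ((int j)\<^sup>2)"
proof -
  have sq: "(int j)\<^sup>2 - 1 = int j * int j - 1" by (simp add: power2_eq_square)
  have "even (int j * int j - 1) \<longleftrightarrow> odd j" by simp
  then have "(- 1) ^ (j + 1) * (- u) powi ((int j)\<^sup>2 - 1) = u powi ((int j)\<^sup>2 - 1)"
    unfolding sq by (cases "even j") (simp_all add: power_int_minus_left)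
  also have "\<dots> = e ((int j)\<^sup>2) / u" by (simp add: e_def power_int_diff)
  finally show ?thesis by (simp add: T_diag_def)
qed

text \<open>Both operators are diagonal, so the weights \<open>c\<close> play the same part on each
  side and may be arbitrary.\<close>

lemma T_reps:
  assumes "\<kappa> \<noteq> 0"
  shows "eq_up_to_scalar (parity_part \<epsilon>) (to_reps \<epsilon> c \<circ> mat_act I T)
     (mat_act (reps \<epsilon>) (T_diag \<kappa> (- u)) \<circ> to_reps \<epsilon> c)"
proof -
  have "to_reps \<epsilon> c (mat_act I T v) =
      cscale (u / \<kappa>) (mat_act (reps \<epsilon>) (T_diag \<kappa> (- u)) (to_reps \<epsilon> c v))" for v
  proof
    fix j
    show "to_reps \<epsilon> c (mat_act I T v) j =
      cscale (u / \<kappa>) (mat_act (reps \<epsilon>) (T_diag \<kappa> (- u)) (to_reps \<epsilon> c v)) j"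
    proof (cases "j \<in> reps \<epsilon>")
      case j: True
      then have jI: "int j \<in> I" using l_half by (auto simp: reps_def split: if_splits)
      have "(\<Sum>r\<in>reps \<epsilon>. T_diag \<kappa> (- u) j r * to_reps \<epsilon> c v r) =
          (\<Sum>r\<in>reps \<epsilon>. if j = r then T_diag \<kappa> (- u) j j * to_reps \<epsilon> c v j else 0)"
        by (rule sum.cong) (auto simp: T_diag_def)
      also have "\<dots> = \<kappa> / u * e ((int j)\<^sup>2) * (c j * v (int j))"
        using j by (simp add: T_diag_neg to_reps_def)
      finally show ?thesis using j assms
        by (simp add: cscale_def mat_act_def [of "reps \<epsilon>"] to_reps_def [of _ _ "mat_act I T v"]
            T_apply [OF jI] del: sum.delta)
    qed (simp add: to_reps_def cscale_def mat_act_def)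
  qed
  then show ?thesis using assms unfolding eq_up_to_scalar_def
    by (intro exI [of _ "u / \<kappa>"]) simp
qed

lemma parity_subrep:
  assumes "projective_rep_by_matrices I S T \<rho>"
  shows "projective_subrep (parity_part \<epsilon>) C \<rho>"
  by (rule projective_subrep_by_matrices [OF assms parity_part_subspace _ S_parity T_parity])
    (auto simp: parity_part_def)

end

section \<open>The quadratic form\<close>

text \<open>With \<open>u = exp (2 pi i k / l)\<close>, the class of \<open>k m / l\<close> lifts
  the power \<open>u powi m\<close> to the rationals modulo the integers.\<close>

lemma root_of_unity_character:
  assumes "0 < l" "u ^ l = 1"
  obtains R :: "int \<Rightarrow> qmodz" where "\<And>m n. R (m + n) = R m + R n"
    "\<And>m. R (int l * m) = 0" "\<And>m. qmodz_exp (R m) = u powi m"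
proof -
  obtain k where k: "u = cis (2 * pi * real k / real l)"
    using Complex.bij_betw_roots_unity [OF assms(1)] assms(2) by (auto simp: bij_betw_def)
  define R where "R m = abs_qmodz (of_int (int k * m) / of_nat l)" for m
  have "R (m + n) = R m + R n" for m n
    by (simp add: R_def plus_qmodz.abs_eq distrib_left add_divide_distrib)
  moreover have "R (int l * m) = 0" for m
    using assms(1) by (simp add: R_def zero_qmodz_def qmodz.abs_eq_iff)
  moreover have "qmodz_exp (R m) = u powi m" for m
  proof -
    have "u powi m = cis (real_of_int m * (2 * pi * real k / real l))"
      by (simp add: k cis_power_int)
    also have "\<dots> = exp (2 * complex_of_real pi * \<i> * of_rat (of_int (int k * m) / of_nat l))"
      by (simp add: cis_conv_exp of_rat_divide of_rat_mult field_simps)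
    finally show ?thesis by (simp add: R_def qmodz_exp.abs_eq)
  qed
  ultimately show ?thesis by (rule that)
qed

context odd_root
begin

text \<open>The form is \<open>x \<mapsto> R (x^2)\<close> for the lifted character
  \<open>R\<close>. Its polar form \<open>R (2 x y)\<close> is bilinear because \<open>R\<close> is
  additive and depends only on residues modulo \<open>l\<close>.\<close>

lemma quadratic_form_exists:
  obtains Q :: "int \<Rightarrow> qmodz"
  where "quadratic_form (integer_mod_group l) Q" "1 < l \<Longrightarrow> nondegenerate (integer_mod_group l) Q"
    "pointed_S (integer_mod_group l) Q = S" "pointed_T Q = T"
proof -
  have "u ^ l = 1" using root by (simp add: primitive_root_of_unity_def)
  obtain R :: "int \<Rightarrow> qmodz" where R: "\<And>m n. R (m + n) = R m + R n"
    "\<And>m. R (int l * m) = 0" "\<And>m. qmodz_exp (R m) = u powi m"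
    by (rule root_of_unity_character [OF l_pos \<open>u ^ l = 1\<close>]) blast
  have R0: "R 0 = 0" using R(2) [of 0] by simp
  have Rminus: "R (- m) = - R m" for m using R(1) [of m "- m"] R0 by (simp add: eq_neg_iff_add_eq_0 add.commute)
  have Rcong: "R m = R n" if "m mod int l = n mod int l" for m n
  proof -
    have "int l dvd m - n" using that by (simp only: mod_eq_dvd_iff)
    then obtain k where "m - n = int l * k" by (rule dvdE)
    then have "m = n + int l * k" by simp
    then show ?thesis using R(1) [of n "int l * k"] R(2) [of k] by (simp only: add_0_right)
  qed
  define Q where "Q x = R (x\<^sup>2)" for x
  have B: "polar_form (integer_mod_group l) Q x y = R (2 * x * y)" for x y
  proof -
    have "Q ((x + y) mod int l) = R ((x + y)\<^sup>2)"
      unfolding Q_def by (rule Rcong) (simp add: power_mod)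
    also have "(x + y)\<^sup>2 = 2 * x * y + x\<^sup>2 + y\<^sup>2" by (simp add: power2_sum)
    finally show ?thesis by (simp add: polar_form_def Q_def R(1))
  qed
  have "quadratic_form (integer_mod_group l) Q"
    unfolding quadratic_form_def B
  proof (intro conjI ballI)
    fix x y z
    show "R (2 * (x \<otimes>\<^bsub>integer_mod_group l\<^esub> y) * z) = R (2 * x * z) + R (2 * y * z)"
      unfolding R(1) [symmetric] mult_integer_mod_group distrib_right [symmetric] distrib_left [symmetric]
      by (intro Rcong mod_mult_cong) auto
    show "R (2 * x * (y \<otimes>\<^bsub>integer_mod_group l\<^esub> z)) = R (2 * x * y) + R (2 * x * z)"
      unfolding R(1) [symmetric] mult_integer_mod_group distrib_left [symmetric]
      by (intro Rcong mod_mult_cong) auto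
    show "Q (inv\<^bsub>integer_mod_group l\<^esub> x) = Q x" if "x \<in> carrier (integer_mod_group l)"
      using that unfolding Q_def by (intro Rcong) (simp add: power_mod)
  qed (auto simp: carrier_integer_mod_group)
  moreover have "nondegenerate (integer_mod_group l) Q" if "1 < l"
    unfolding nondegenerate_def B
  proof (intro ballI impI)
    fix x assume x: "x \<in> carrier (integer_mod_group l)"
      and "\<forall>y\<in>carrier (integer_mod_group l). R (2 * x * y) = 0"
    \<comment> \<open>Testing against \<open>y = 1\<close> suffices; \<open>1 < l\<close> puts 1
      into the carrier.\<close>
    then have "R (2 * x) = 0" using that by (auto dest: bspec [of _ _ 1])
    then have "e (2 * x) = 1" using R(3) [of "2 * x"] R(3) [of 0] R0 by (simp add: e_def)
    then show "x = \<one>\<^bsub>integer_mod_group l\<^esub>"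
      using x dvd_in_I [of x] by (simp add: e_eq_1_iff dvd_double_iff carrier_integer_mod_group)
  qed
  moreover have "pointed_S (integer_mod_group l) Q = S"
    by (simp add: fun_eq_iff pointed_S_def B S_def e_def R(3) flip: Rminus)
  moreover have "pointed_T Q = T"
    by (simp add: fun_eq_iff pointed_T_def T_def Q_def e_def R(3))
  ultimately show ?thesis using that by blast
qed

end

section \<open>Existence of the three representations and the decomposition\<close>

theorem lemma5p3p1:
  fixes l h :: nat and q p \<kappa> :: complex
  assumes "l = 2 * h + 1" and "l \<ge> 3"
    and "primitive_root_of_unity l q"
    and "p ^ 2 = q" and "p ^ l = -1"
    and "\<kappa> \<noteq> 0"
  shows "\<exists>Q :: int \<Rightarrow> qmodz.
    quadratic_form (integer_mod_group l) Q \<and>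
    nondegenerate (integer_mod_group l) Q \<and>
    (\<exists>\<rho>. is_pointed_rep (integer_mod_group l) Q \<rho>) \<and>
    (\<exists>\<sigma>. is_P_rep h q p \<kappa> \<sigma>) \<and>
    (\<exists>\<tau>. is_V_rep h q p \<kappa> \<tau>) \<and>
    (\<forall>\<rho> \<sigma> \<tau>.
       is_pointed_rep (integer_mod_group l) Q \<rho> \<longrightarrow>
       is_P_rep h q p \<kappa> \<sigma> \<longrightarrow>
       is_V_rep h q p \<kappa> \<tau> \<longrightarrow>
       (let C = coord_space (carrier (integer_mod_group l));
            V_even = even_part (integer_mod_group l);
            V_odd = odd_part (integer_mod_group l)
        in direct_sum_of C V_even V_odd \<and>
           projective_subrep V_even C \<rho> \<and>
           projective_subrep V_odd C \<rho> \<and>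
           projective_equiv V_even \<rho> (coord_space {0..h}) \<sigma> \<and>
           projective_equiv V_odd \<rho> (coord_space {1..h}) \<tau>))"
proof -
  let ?G = "integer_mod_group l"
  define u where "u = - p"
  have u2: "u\<^sup>2 = q" and p: "p = - u" using assms(4) by (simp_all add: u_def)
  have odd: "odd l" and l1: "1 < l" using assms(1,2) by simp_all
  have "u ^ l = 1" using odd assms(5) by (simp add: u_def)
  \<comment> \<open>The order of \<open>u\<close> is exactly \<open>l\<close>, since a smaller
    exponent would also kill \<open>q = u^2\<close>.\<close>
  moreover have "u ^ k \<noteq> 1" if "0 < k" "k < l" for k
  proof
    assume "u ^ k = 1"
    then have "q ^ k = 1" unfolding u2 [symmetric] by (metis mult.commute power_mult power_one)
    then show False using assms(3) that by (simp add: primitive_root_of_unity_def)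
  qed
  ultimately interpret odd_root l u
    using odd l1 by unfold_locales (auto simp: primitive_root_of_unity_def)
  have h: "half = h" using l_half assms(1) by simp
  have carrier: "carrier ?G = I" by (simp add: carrier_integer_mod_group)
  have even: "even_part ?G = parity_part 1" and odd: "odd_part ?G = parity_part (- 1)"
    by (auto simp: even_part_def odd_part_def parity_part_def carrier_integer_mod_group)
  obtain Q where Q: "quadratic_form ?G Q" "1 < l \<Longrightarrow> nondegenerate ?G Q"
    "pointed_S ?G Q = S" "pointed_T Q = T" by (rule quadratic_form_exists) blast
  have pointed: "is_pointed_rep ?G Q \<rho> \<longleftrightarrow> projective_rep_by_matrices I S T \<rho>" for \<rho>
    by (simp add: is_pointed_rep_def Q carrier)
  have P: "is_P_rep h q p \<kappa> \<sigma> \<longleftrightarrow>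
      projective_rep_by_matrices {0..half} (S_N l (u\<^sup>2)) (T_diag \<kappa> (- u)) \<sigma>" for \<sigma>
    by (simp only: is_P_rep_def h u2 p assms(1) [symmetric])
  have V: "is_V_rep h q p \<kappa> \<tau> \<longleftrightarrow>
      projective_rep_by_matrices {1..half} (S_V l (u\<^sup>2)) (T_diag \<kappa> (- u)) \<tau>" for \<tau>
    by (simp only: is_V_rep_def h u2 p assms(1) [symmetric])
  have r1: "reps 1 = {0..half}" and r2: "reps (- 1) = {1..half}" by (simp_all add: reps_def)
  have be: "bij_betw (to_reps 1 even_weight) (parity_part 1) (coord_space {0..half})"
    and bo: "bij_betw (to_reps (- 1) (\<lambda>_. 1)) (parity_part (- 1)) (coord_space {1..half})"
    using to_reps_bij [of 1 even_weight] to_reps_bij [of "- 1" "\<lambda>_. 1"] by (simp_all add: r1 r2)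
  have fe: "v \<in> parity_part 1 \<Longrightarrow> from_reps 1 even_weight (to_reps 1 even_weight v) = v"
    and fo: "v \<in> parity_part (- 1) \<Longrightarrow> from_reps (- 1) (\<lambda>_. 1) (to_reps (- 1) (\<lambda>_. 1) v) = v" for v
    by (rule from_to_reps; simp)+
  \<comment> \<open>Existence of the two smaller representations is read off the parity parts of
    \<open>weil\<close>; the equivalences that follow hold for arbitrary representations with the
    prescribed generator matrices.\<close>
  note Te = T_reps [OF assms(6), of 1 even_weight, unfolded r1]
    and To = T_reps [OF assms(6), of "- 1" "\<lambda>_. 1", unfolded r2]
  have "\<exists>\<sigma>. is_P_rep h q p \<kappa> \<sigma>" unfolding P
    by (rule subrep_by_matrices_transport [OF weil_rep parity_subrep [OF weil_rep] to_reps_linear be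
          from_reps_linear fe S_even Te])
  moreover have "\<exists>\<tau>. is_V_rep h q p \<kappa> \<tau>" unfolding V
    by (rule subrep_by_matrices_transport [OF weil_rep parity_subrep [OF weil_rep] to_reps_linear bo
          from_reps_linear fo S_odd To])
  moreover have "projective_equiv (parity_part 1) \<rho> (coord_space {0..h}) \<sigma>"
    if "is_pointed_rep ?G Q \<rho>" "is_P_rep h q p \<kappa> \<sigma>" for \<rho> \<sigma>
    using subrep_by_matrices_equiv [OF _ parity_subrep to_reps_linear be S_even Te] that
    by (simp add: pointed P h)
  moreover have "projective_equiv (parity_part (- 1)) \<rho> (coord_space {1..h}) \<tau>"
    if "is_pointed_rep ?G Q \<rho>" "is_V_rep h q p \<kappa> \<tau>" for \<rho> \<tau>
    using subrep_by_matrices_equiv [OF _ parity_subrep to_reps_linear bo S_odd To] that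
    by (simp add: pointed V h)
  moreover have "\<exists>\<rho>. is_pointed_rep ?G Q \<rho>" using weil_rep pointed by blast
  ultimately show ?thesis
    using Q(1) Q(2) [OF l1] parity_direct_sum parity_subrep pointed
    unfolding Let_def carrier even odd by blast
qed

end
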